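(* If $\Delta_i\sim_s\Theta_i$ for $i=1,2$ and $p\in[0,1]$, then $\Delta_1\oplus_p\Delta_2\sim_s\Theta_1\oplus_p\Theta_2$.
   Context: Notation. $\mathcal D(S)$: finitely supported probability distributions on $S$; $\overline{s}$: point distribution; $\sum_ip_i\bullet\Delta_i$: convex combination; $\Delta_1\oplus_p\Delta_2=p\bullet\Delta_1+(1-p)\bullet\Delta_2$. Qubit names from a denumerable set $\mathcal Q$; $\mathcal H_\Sigma=(\mathbb C^2)^{\otimes|\Sigma|}$; superoperators $\rho\mapsto\sum_iE_i\rho E_i^\dagger$ (trace-preserving if $\sum E_i^\dagger E_i=\mathbb I$); measurements $\mathbb M=\{M_m\}$ with $\sum M_m^\dagger M_m=\mathbb I$, $\mathcal M_m(\sigma)=M_m\sigma M_m^\dagger$; $\mathcal E^{\tilde q}$ applies $\mathcal E$ to qubits $\tilde q$ and the identity elsewhere. Syntax (tagged lqCCS): tags $t\in\mathit{Tag}$; channels typed $\widehat{\mathbb N},\widehat{\mathbb B},\widehat{\mathcal Q}$; $P::=t:\tau.P\mid (t,t'):\tau.P\mid t:\mathcal E(\tilde e).P\mid t:\mathbb M(\tilde e\rhd x).P\mid t:c?x.P\mid \mathbf 0_{\tilde e}\mid t:c!e.P\mid \mathrm{if}\ e\ \mathrm{then}\ P\ \mathrm{else}\ P\mid P+P\mid P\parallel P\mid P\setminus c$; expressions $e::=x\mid b\mid n\mid q\mid\neg e\mid e\lor e\mid e\le e\mid e=e$, evaluated by $e\Downarrow v$. Typing: $\Sigma\vdash\mathbf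 0_{\tilde e}$ if $\tilde e$ enumerates $\Sigma$; prefixes $\tau$, classical send/receive, superoperator and measurement on $\tilde e$ (enumerating a subset of $\Sigma$ of the right size), restriction keep $\Sigma$; sum and if-then-else need both branches typed by $\Sigma$; quantum receive $\Sigma\vdash t:c?x.P$ if $\Sigma\cup\{x\}\vdash P$; quantum send $\Sigma\vdash t:c!e.P$ if $e\in\Sigma$, $\Sigma\setminus\{e\}\vdash P$; $\Sigma_1\cup\Sigma_2\vdash P_1\parallel P_2$ if $\Sigma_1\cap\Sigma_2=\emptyset$, $\Sigma_i\vdash P_i$. Unique typing $\Sigma_P$. Configurations $\langle\rho,P\rangle$ ($\rho$ density operator on $\mathcal H_{\Sigma_\rho}$, $P$ closed), typed $(\Sigma_\rho,\Sigma_P)$ when $\Sigma_P\subseteq\Sigma_\rho$; $\mathit{Conf}_\bot=\mathit{Conf}\cup\{\bot\}$, $\bot$ typed by every pair; distributions typed if all support elements are. Only well-typed distributions are considered. Mass $|\Delta|=1-\Delta(\bot)$. Semantics: schedulers $s::=h\mid t\mid(t,t')$; actions $\tau,c!v,c?v$; transitions $\langle\rho,P\rangle\xrightarrow{\mu}_s\Delta$: least relation with $\langle\rho,t:\tau.P\rangle\xrightarrow{\tau}_t\overline{\langle\rho,P\rangle}$; $\langle\rho,(t,t'):\tau.P\rangle\xrightarrow{\tau}_{(t,t')}\overline{\langle\rho,P\rangle}$; $\langle\rho,t:c!e.P\rangle\xrightarrow{c!v}_t\overline{\langle\rho,P\rangle}$ if $e\Downarrow v$; $\langle\rho,t:c?x.P\rangle\xrightarrow{c?v}_t\overline{\langle\rho,P[v/x]\rangle}$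 ($v\in\Sigma_\rho$ if quantum); $\langle\rho,t:\mathcal E(\tilde q).P\rangle\xrightarrow{\tau}_t\overline{\langle\mathcal E^{\tilde q}(\rho),P\rangle}$; $\langle\rho,t:\mathbb M(\tilde q\rhd y).P\rangle\xrightarrow{\tau}_t\sum_mp_m\bullet\overline{\langle\mathcal M^{\tilde q}_m(\rho)/p_m,P[m/y]\rangle}$, $p_m=\mathrm{tr}(\mathcal M^{\tilde q}_m(\rho))$; if-then-else follows the branch selected by $e$; $P+Q$ has the transitions of both; restriction passes actions other than $c!v,c?v$; $\langle\rho,P\parallel Q\rangle\xrightarrow{\mu}_s\Delta\parallel Q$ if $\langle\rho,P\rangle\xrightarrow{\mu}_s\Delta$ and $\mu$ is not $c?v$ with $v\in\Sigma_Q$ (and symmetrically); if $\langle\rho,P\rangle\xrightarrow{c!v}_t\overline{\langle\rho,P'\rangle}$, $\langle\rho,Q\rangle\xrightarrow{c?v}_{t'}\overline{\langle\rho,Q'\rangle}$ then $\langle\rho,P\parallel Q\rangle\xrightarrow{\tau}_{(t,t')}\overline{\langle\rho,P'\parallel Q'\rangle}$ and $\langle\rho,Q\parallel P\rangle\xrightarrow{\tau}_{(t,t')}\overline{\langle\rho,Q'\parallel P'\rangle}$. Lifting: on $\mathit{Conf}_\bot$, $\mathcal C\xrightarrow{\mu}_s\overline\bot$ is added whenever $\mathcal C$ (including $\bot$) has no $\xrightarrow{\mu}_s$ transition. For a distribution of schedulers $\delta=\sum_jr_j\bullet\overline{s_j}$, $\mathcal C\xrightarrow{\mu}_\delta\sum_jr_j\bullet\Theta_j$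 whenever $\mathcal C\xrightarrow{\mu}_{s_j}\Theta_j$ for all $j$; for $\Delta=\sum_ip_i\bullet\overline{\mathcal C_i}$, $\Delta\xrightarrow{\mu}_\delta\sum_ip_i\bullet\Delta_i$ whenever $\mathcal C_i\xrightarrow{\mu}_\delta\Delta_i$ for all $i$. Standing assumption: processes are tagged deterministically, i.e. $\Delta\xrightarrow{\mu}_\delta\Delta'$ and $\Delta\xrightarrow{\mu}_\delta\Delta''$ imply $\Delta'=\Delta''$. Contexts: $B[\cdot]_\Sigma=[\cdot]_\Sigma\parallel Q$, typed $\Sigma'\vdash B[\cdot]_\Sigma$ if $\Sigma\subseteq\Sigma'$ and $\Sigma'\setminus\Sigma\vdash Q$; $B[\langle\rho,P\rangle]=\langle\rho,P\parallel Q\rangle$, defined when $\Sigma_P=\Sigma$ and $\Sigma'\subseteq\Sigma_\rho$; $B[\bot]=\bot$; extended pointwise to distributions. Saturated bisimilarity: $\mathcal R\subseteq\mathcal D(\mathit{Conf}_\bot)\times\mathcal D(\mathit{Conf}_\bot)$ is a saturated bisimulation if $\Delta\mathcal R\Theta$ implies: $(\Sigma,\Sigma')\vdash\Delta$ and $(\Sigma,\Sigma')\vdash\Theta$ for some $\Sigma,\Sigma'$; $|\Delta|=|\Theta|$; for every context $B[\cdot]_{\Sigma'}$ and distribution of schedulers $\delta$, if $B[\Delta]\xrightarrow{\tau}_\delta\Delta'$ then $B[\Theta]\xrightarrow{\tau}_\delta\Theta'$ for some $\Theta'$ with $\Delta'\mathcal R\Theta'$, and symmetrically. $\sim_s$ is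 the largest saturated bisimulation. *)

theory Defs
  imports
    "HOL-Probability.Probability_Mass_Function"
    "Jordan_Normal_Form.Schur_Decomposition"
begin

section \<open>Quantum states and operations\<close>

type_synonym qubit = nat

text \<open>
  An operator on the state space of a finite set \<open>S\<close> of qubits is a matrix of dimension
  \<open>2 ^ card S\<close>. Tensor factors are ordered by increasing qubit name, the first factor being the
  most significant bit of a basis index. An operator on a list of \<open>n\<close> qubits is a matrix of
  dimension \<open>2 ^ n\<close>; there the head of the list is the most significant bit.
\<close>

definition qubit_bit :: "qubit set \<Rightarrow> nat \<Rightarrow> qubit \<Rightarrow> bool" where
  "qubit_bit S i q = bit i (card {q' \<in> S. q < q'})"

definition sub_index :: "qubit set \<Rightarrow> qubit list \<Rightarrow> nat \<Rightarrow> nat" where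
  "sub_index S qs i = horner_sum of_bool 2 (rev (map (qubit_bit S i) qs))"

text \<open>The operator acting as \<open>A\<close> on the qubits \<open>qs\<close> and as the identity on the rest of \<open>S\<close>.\<close>

definition lift_op :: "qubit set \<Rightarrow> qubit list \<Rightarrow> complex mat \<Rightarrow> complex mat" where
  "lift_op S qs A = mat (2 ^ card S) (2 ^ card S) (\<lambda>(i, j).
     if \<forall>q \<in> S - set qs. qubit_bit S i q = qubit_bit S j q
     then A $$ (sub_index S qs i, sub_index S qs j) else 0)"

definition mat_trace :: "complex mat \<Rightarrow> complex" where
  "mat_trace A = (\<Sum>i<dim_row A. A $$ (i, i))"

text \<open>The condition \<open>0 \<le> z\<close> for complex \<open>z\<close> says that \<open>z\<close> is real and nonnegative, so
  positivity includes hermiticity.\<close>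

definition density_op :: "nat \<Rightarrow> complex mat \<Rightarrow> bool" where
  "density_op d \<rho> \<longleftrightarrow> \<rho> \<in> carrier_mat d d \<and>
     (\<forall>v \<in> carrier_vec d. 0 \<le> (\<rho> *\<^sub>v v) \<bullet>c v) \<and> mat_trace \<rho> = 1"

definition mat_sum :: "nat \<Rightarrow> complex mat list \<Rightarrow> complex mat" where
  "mat_sum d As = foldr (+) As (0\<^sub>m d d)"

text \<open>
  Superoperators are given by their lists of Kraus operators, measurements by the list of
  operators \<open>M\<^sub>m\<close>, with outcomes \<open>m\<close> the list positions. In both cases the completeness equation
  \<open>\<Sum>\<^sub>i E\<^sub>i\<^sup>\<dagger> E\<^sub>i = I\<close> is required (for a superoperator it expresses trace preservation).
\<close>

definition complete_ops :: "nat \<Rightarrow> complex mat list \<Rightarrow> bool" where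
  "complete_ops n Es \<longleftrightarrow> set Es \<subseteq> carrier_mat (2 ^ n) (2 ^ n) \<and>
     mat_sum (2 ^ n) (map (\<lambda>E. mat_adjoint E * E) Es) = 1\<^sub>m (2 ^ n)"

definition conj_op :: "qubit set \<Rightarrow> qubit list \<Rightarrow> complex mat \<Rightarrow> complex mat \<Rightarrow> complex mat" where
  "conj_op S qs E \<rho> = lift_op S qs E * \<rho> * mat_adjoint (lift_op S qs E)"

definition superop_apply ::
  "qubit set \<Rightarrow> qubit list \<Rightarrow> complex mat list \<Rightarrow> complex mat \<Rightarrow> complex mat" where
  "superop_apply S qs Es \<rho> = mat_sum (2 ^ card S) (map (\<lambda>E. conj_op S qs E \<rho>) Es)"


section \<open>Syntax of tagged lqCCS\<close>

datatype ty = TNat | TBool | TQubit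

datatype val = VNat nat | VBool bool | VQubit qubit

text \<open>Variables and channels carry their type; a channel \<open>c\<close> transmits values of type \<open>chan_ty c\<close>.\<close>

datatype var = Var (var_ty: ty) (var_id: nat)

datatype chan = Chan (chan_ty: ty) (chan_id: nat)

datatype expr =
    EVar var
  | EVal val
  | ENot expr
  | EOr expr expr
  | ELe expr expr
  | EEq expr expr

datatype 't proc =
    Tau 't "'t proc"
  | Tau2 't 't "'t proc"
  | Sop 't "complex mat list" "expr list" "'t proc"
  | Meas 't "complex mat list" "expr list" var "'t proc"
  | Recv 't chan var "'t proc"
  | Discard "expr list"  \<comment> \<open>the process \<open>\<zero>\<close> indexed by a list\<close>
  | Send 't chan expr "'t proc"
  | Cond expr "'t proc" "'t proc"
  | Sum "'t proc" "'t proc"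
  | Par "'t proc" "'t proc"
  | Restr "'t proc" chan

inductive eval :: "expr \<Rightarrow> val \<Rightarrow> bool" (infix "\<Down>" 50) where
  "EVal v \<Down> v"
| "e \<Down> VBool b \<Longrightarrow> ENot e \<Down> VBool (\<not> b)"
| "e \<Down> VBool a \<Longrightarrow> f \<Down> VBool b \<Longrightarrow> EOr e f \<Down> VBool (a \<or> b)"
| "e \<Down> VNat m \<Longrightarrow> f \<Down> VNat n \<Longrightarrow> ELe e f \<Down> VBool (m \<le> n)"
| "e \<Down> v \<Longrightarrow> f \<Down> w \<Longrightarrow> EEq e f \<Down> VBool (v = w)"

primrec fv_expr :: "expr \<Rightarrow> var set" where
  "fv_expr (EVar x) = {x}"
| "fv_expr (EVal v) = {}"
| "fv_expr (ENot e) = fv_expr e"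
| "fv_expr (EOr e f) = fv_expr e \<union> fv_expr f"
| "fv_expr (ELe e f) = fv_expr e \<union> fv_expr f"
| "fv_expr (EEq e f) = fv_expr e \<union> fv_expr f"

primrec fv :: "'t proc \<Rightarrow> var set" where
  "fv (Tau t P) = fv P"
| "fv (Tau2 t t' P) = fv P"
| "fv (Sop t Es es P) = \<Union> (fv_expr ` set es) \<union> fv P"
| "fv (Meas t Ms es x P) = \<Union> (fv_expr ` set es) \<union> (fv P - {x})"
| "fv (Recv t c x P) = fv P - {x}"
| "fv (Discard es) = \<Union> (fv_expr ` set es)"
| "fv (Send t c e P) = fv_expr e \<union> fv P"
| "fv (Cond e P Q) = fv_expr e \<union> fv P \<union> fv Q"
| "fv (Sum P Q) = fv P \<union> fv Q"
| "fv (Par P Q) = fv P \<union> fv Q"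
| "fv (Restr P c) = fv P"

abbreviation closed_proc :: "'t proc \<Rightarrow> bool" where
  "closed_proc P \<equiv> fv P = {}"

primrec subst_expr :: "val \<Rightarrow> var \<Rightarrow> expr \<Rightarrow> expr" where
  "subst_expr v x (EVar y) = (if y = x then EVal v else EVar y)"
| "subst_expr v x (EVal w) = EVal w"
| "subst_expr v x (ENot e) = ENot (subst_expr v x e)"
| "subst_expr v x (EOr e f) = EOr (subst_expr v x e) (subst_expr v x f)"
| "subst_expr v x (ELe e f) = ELe (subst_expr v x e) (subst_expr v x f)"
| "subst_expr v x (EEq e f) = EEq (subst_expr v x e) (subst_expr v x f)"

text \<open>\<open>subst v x P\<close> is \<open>P[v/x]\<close>; no capture can occur because \<open>v\<close> is a value.\<close>

primrec subst :: "val \<Rightarrow> var \<Rightarrow> 't proc \<Rightarrow> 't proc" where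
  "subst v x (Tau t P) = Tau t (subst v x P)"
| "subst v x (Tau2 t t' P) = Tau2 t t' (subst v x P)"
| "subst v x (Sop t Es es P) = Sop t Es (map (subst_expr v x) es) (subst v x P)"
| "subst v x (Meas t Ms es y P) =
     Meas t Ms (map (subst_expr v x) es) y (if y = x then P else subst v x P)"
| "subst v x (Recv t c y P) = Recv t c y (if y = x then P else subst v x P)"
| "subst v x (Discard es) = Discard (map (subst_expr v x) es)"
| "subst v x (Send t c e P) = Send t c (subst_expr v x e) (subst v x P)"
| "subst v x (Cond e P Q) = Cond (subst_expr v x e) (subst v x P) (subst v x Q)"
| "subst v x (Sum P Q) = Sum (subst v x P) (subst v x Q)"
| "subst v x (Par P Q) = Par (subst v x P) (subst v x Q)"
| "subst v x (Restr P c) = Restr (subst v x P) c"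


section \<open>Typing\<close>

primrec val_ty :: "val \<Rightarrow> ty" where
  "val_ty (VNat n) = TNat"
| "val_ty (VBool b) = TBool"
| "val_ty (VQubit q) = TQubit"

inductive expr_typed :: "expr \<Rightarrow> ty \<Rightarrow> bool" where
  "expr_typed (EVar x) (var_ty x)"
| "expr_typed (EVal v) (val_ty v)"
| "expr_typed e TBool \<Longrightarrow> expr_typed (ENot e) TBool"
| "expr_typed e TBool \<Longrightarrow> expr_typed f TBool \<Longrightarrow> expr_typed (EOr e f) TBool"
| "expr_typed e TNat \<Longrightarrow> expr_typed f TNat \<Longrightarrow> expr_typed (ELe e f) TBool"
| "expr_typed e T \<Longrightarrow> expr_typed f T \<Longrightarrow> expr_typed (EEq e f) TBool"

text \<open>
  \<open>\<Sigma>\<close> contains qubit names and quantum variables, both represented as expressions. The side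
  condition \<open>EVar x \<notin> \<Sigma>\<close> of quantum reception makes the type of a process unique: without it, a
  bound \<open>x\<close> could silently shadow an \<open>x\<close> already owned by the process.
\<close>

inductive proc_typed :: "expr set \<Rightarrow> 't proc \<Rightarrow> bool" (infix "\<turnstile>" 50) where
  typed_Discard: "distinct es \<Longrightarrow> set es = \<Sigma> \<Longrightarrow> \<Sigma> \<turnstile> Discard es"
| typed_Tau: "\<Sigma> \<turnstile> P \<Longrightarrow> \<Sigma> \<turnstile> Tau t P"
| typed_Tau2: "\<Sigma> \<turnstile> P \<Longrightarrow> \<Sigma> \<turnstile> Tau2 t t' P"
| typed_Sop: "distinct es \<Longrightarrow> set es \<subseteq> \<Sigma> \<Longrightarrow> complete_ops (length es) Es \<Longrightarrow>
    \<Sigma> \<turnstile> P \<Longrightarrow> \<Sigma> \<turnstile> Sop t Es es P"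
| typed_Meas: "distinct es \<Longrightarrow> set es \<subseteq> \<Sigma> \<Longrightarrow> complete_ops (length es) Ms \<Longrightarrow>
    var_ty x = TNat \<Longrightarrow> \<Sigma> \<turnstile> P \<Longrightarrow> \<Sigma> \<turnstile> Meas t Ms es x P"
| typed_CRecv: "chan_ty c \<noteq> TQubit \<Longrightarrow> var_ty x = chan_ty c \<Longrightarrow> \<Sigma> \<turnstile> P \<Longrightarrow> \<Sigma> \<turnstile> Recv t c x P"
| typed_QRecv: "chan_ty c = TQubit \<Longrightarrow> var_ty x = TQubit \<Longrightarrow> EVar x \<notin> \<Sigma> \<Longrightarrow>
    \<Sigma> \<union> {EVar x} \<turnstile> P \<Longrightarrow> \<Sigma> \<turnstile> Recv t c x P"
| typed_CSend: "chan_ty c \<noteq> TQubit \<Longrightarrow> expr_typed e (chan_ty c) \<Longrightarrow> \<Sigma> \<turnstile> P \<Longrightarrow>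
    \<Sigma> \<turnstile> Send t c e P"
| typed_QSend: "chan_ty c = TQubit \<Longrightarrow> expr_typed e TQubit \<Longrightarrow> e \<in> \<Sigma> \<Longrightarrow> \<Sigma> - {e} \<turnstile> P \<Longrightarrow>
    \<Sigma> \<turnstile> Send t c e P"
| typed_Cond: "expr_typed e TBool \<Longrightarrow> \<Sigma> \<turnstile> P \<Longrightarrow> \<Sigma> \<turnstile> Q \<Longrightarrow> \<Sigma> \<turnstile> Cond e P Q"
| typed_Sum: "\<Sigma> \<turnstile> P \<Longrightarrow> \<Sigma> \<turnstile> Q \<Longrightarrow> \<Sigma> \<turnstile> Sum P Q"
| typed_Par: "\<Sigma>1 \<inter> \<Sigma>2 = {} \<Longrightarrow> \<Sigma>1 \<turnstile> P \<Longrightarrow> \<Sigma>2 \<turnstile> Q \<Longrightarrow> \<Sigma>1 \<union> \<Sigma>2 \<turnstile> Par P Q"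
| typed_Restr: "\<Sigma> \<turnstile> P \<Longrightarrow> \<Sigma> \<turnstile> Restr P c"

inductive_cases typedE:
  "\<Sigma> \<turnstile> Tau t P" "\<Sigma> \<turnstile> Tau2 t t' P" "\<Sigma> \<turnstile> Sop t Es es P" "\<Sigma> \<turnstile> Meas t Ms es x P"
  "\<Sigma> \<turnstile> Recv t c x P" "\<Sigma> \<turnstile> Discard es" "\<Sigma> \<turnstile> Send t c e P" "\<Sigma> \<turnstile> Cond e P Q"
  "\<Sigma> \<turnstile> Sum P Q" "\<Sigma> \<turnstile> Par P Q" "\<Sigma> \<turnstile> Restr P c"

lemma proc_typed_unique: "\<Sigma> \<turnstile> P \<Longrightarrow> \<Sigma>' \<turnstile> P \<Longrightarrow> \<Sigma> = \<Sigma>'"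
proof (induction arbitrary: \<Sigma>' rule: proc_typed.induct)
  case (typed_QRecv c x \<Sigma> P t)
  from typed_QRecv.prems typed_QRecv.hyps have "EVar x \<notin> \<Sigma>'" "\<Sigma>' \<union> {EVar x} \<turnstile> P"
    by (auto elim: typedE(5))
  with typed_QRecv.IH typed_QRecv.hyps show ?case by blast
next
  case (typed_QSend c e \<Sigma> P t)
  from typed_QSend.prems typed_QSend.hyps have "e \<in> \<Sigma>'" "\<Sigma>' - {e} \<turnstile> P"
    by (auto elim: typedE(7))
  with typed_QSend.IH typed_QSend.hyps show ?case by blast
qed (erule typedE; metis)+

text \<open>The unique type \<open>\<Sigma>\<^sub>P\<close> of a process.\<close>

definition proc_type :: "'t proc \<Rightarrow> expr set" where
  "proc_type P = (THE \<Sigma>. \<Sigma> \<turnstile> P)"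

definition qnames :: "qubit set \<Rightarrow> expr set" where
  "qnames S = (\<lambda>q. EVal (VQubit q)) ` S"


section \<open>Configurations and distributions\<close>

datatype 't conf = Conf (reg: "qubit set") (state: "complex mat") (cproc: "'t proc")

text \<open>\<open>None\<close> plays the role of \<open>\<bottom>\<close>.\<close>

type_synonym 't dist = "'t conf option pmf"

definition conf_typed :: "qubit set \<Rightarrow> qubit set \<Rightarrow> 't conf \<Rightarrow> bool" where
  "conf_typed S S' C \<longleftrightarrow> reg C = S \<and> finite S \<and> density_op (2 ^ card S) (state C) \<and>
     closed_proc (cproc C) \<and> qnames S' \<turnstile> cproc C \<and> S' \<subseteq> S"

definition dist_typed :: "qubit set \<Rightarrow> qubit set \<Rightarrow> 't dist \<Rightarrow> bool" where
  "dist_typed S S' \<Delta> \<longleftrightarrow> finite (set_pmf \<Delta>) \<and> (\<forall>C. Some C \<in> set_pmf \<Delta> \<longrightarrow> conf_typed S S' C)"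

definition well_typed :: "'t dist \<Rightarrow> bool" where
  "well_typed \<Delta> \<longleftrightarrow> (\<exists>S S'. dist_typed S S' \<Delta>)"

definition mass :: "'t dist \<Rightarrow> real" where
  "mass \<Delta> = 1 - pmf \<Delta> None"

text \<open>The distribution \<open>p \<bullet> \<Delta> + (1 - p) \<bullet> \<Theta>\<close>, for \<open>0 \<le> p \<le> 1\<close>.\<close>

definition pchoice :: "real \<Rightarrow> 'a pmf \<Rightarrow> 'a pmf \<Rightarrow> 'a pmf" where
  "pchoice p \<Delta> \<Theta> = bind_pmf (bernoulli_pmf p) (\<lambda>b. if b then \<Delta> else \<Theta>)"


section \<open>Operational semantics\<close>

datatype act = ATau | ASend chan val | ARecv chan val

datatype 't sched = Halt | One 't | Two 't 't

definition map_cproc :: "('t proc \<Rightarrow> 't proc) \<Rightarrow> 't conf \<Rightarrow> 't conf" where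
  "map_cproc f C = Conf (reg C) (state C) (f (cproc C))"

text \<open>
  In the measurement rule \<open>M\<close> is the distribution of outcomes, \<open>p\<^sub>m = tr (M\<^sub>m \<rho> M\<^sub>m\<^sup>\<dagger>)\<close>; outcomes of
  probability zero are not in its support and do not contribute to the target.
\<close>

inductive trans :: "'t conf \<Rightarrow> act \<Rightarrow> 't sched \<Rightarrow> 't conf pmf \<Rightarrow> bool" where
  trans_Tau: "trans (Conf S \<rho> (Tau t P)) ATau (One t) (return_pmf (Conf S \<rho> P))"
| trans_Tau2: "trans (Conf S \<rho> (Tau2 t t' P)) ATau (Two t t') (return_pmf (Conf S \<rho> P))"
| trans_Send: "e \<Down> v \<Longrightarrow>
    trans (Conf S \<rho> (Send t c e P)) (ASend c v) (One t) (return_pmf (Conf S \<rho> P))"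
| trans_Recv: "val_ty v = chan_ty c \<Longrightarrow> (\<forall>q. v = VQubit q \<longrightarrow> q \<in> S) \<Longrightarrow>
    trans (Conf S \<rho> (Recv t c x P)) (ARecv c v) (One t) (return_pmf (Conf S \<rho> (subst v x P)))"
| trans_Sop:
    "trans (Conf S \<rho> (Sop t Es (map (\<lambda>q. EVal (VQubit q)) qs) P)) ATau (One t)
       (return_pmf (Conf S (superop_apply S qs Es \<rho>) P))"
| trans_Meas: "(\<And>m. complex_of_real (pmf M m) =
      (if m < length Ms then mat_trace (conj_op S qs (Ms ! m) \<rho>) else 0)) \<Longrightarrow>
    trans (Conf S \<rho> (Meas t Ms (map (\<lambda>q. EVal (VQubit q)) qs) y P)) ATau (One t)
      (map_pmf (\<lambda>m. Conf S (complex_of_real (1 / pmf M m) \<cdot>\<^sub>m conj_op S qs (Ms ! m) \<rho>)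
         (subst (VNat m) y P)) M)"
| trans_CondT: "e \<Down> VBool True \<Longrightarrow> trans (Conf S \<rho> P) \<mu> s \<Theta> \<Longrightarrow>
    trans (Conf S \<rho> (Cond e P Q)) \<mu> s \<Theta>"
| trans_CondF: "e \<Down> VBool False \<Longrightarrow> trans (Conf S \<rho> Q) \<mu> s \<Theta> \<Longrightarrow>
    trans (Conf S \<rho> (Cond e P Q)) \<mu> s \<Theta>"
| trans_SumL: "trans (Conf S \<rho> P) \<mu> s \<Theta> \<Longrightarrow> trans (Conf S \<rho> (Sum P Q)) \<mu> s \<Theta>"
| trans_SumR: "trans (Conf S \<rho> Q) \<mu> s \<Theta> \<Longrightarrow> trans (Conf S \<rho> (Sum P Q)) \<mu> s \<Theta>"
| trans_Restr: "trans (Conf S \<rho> P) \<mu> s \<Theta> \<Longrightarrow> (\<forall>v. \<mu> \<noteq> ASend c v \<and> \<mu> \<noteq> ARecv c v) \<Longrightarrow>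
    trans (Conf S \<rho> (Restr P c)) \<mu> s (map_pmf (map_cproc (\<lambda>P'. Restr P' c)) \<Theta>)"
| trans_ParL: "trans (Conf S \<rho> P) \<mu> s \<Theta> \<Longrightarrow>
    (\<forall>c v. \<mu> = ARecv c v \<longrightarrow> EVal v \<notin> proc_type Q) \<Longrightarrow>
    trans (Conf S \<rho> (Par P Q)) \<mu> s (map_pmf (map_cproc (\<lambda>P'. Par P' Q)) \<Theta>)"
| trans_ParR: "trans (Conf S \<rho> Q) \<mu> s \<Theta> \<Longrightarrow>
    (\<forall>c v. \<mu> = ARecv c v \<longrightarrow> EVal v \<notin> proc_type P) \<Longrightarrow>
    trans (Conf S \<rho> (Par P Q)) \<mu> s (map_pmf (map_cproc (\<lambda>Q'. Par P Q')) \<Theta>)"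
| trans_SyncL: "trans (Conf S \<rho> P) (ASend c v) (One t) (return_pmf (Conf S \<rho> P')) \<Longrightarrow>
    trans (Conf S \<rho> Q) (ARecv c v) (One t') (return_pmf (Conf S \<rho> Q')) \<Longrightarrow>
    trans (Conf S \<rho> (Par P Q)) ATau (Two t t') (return_pmf (Conf S \<rho> (Par P' Q')))"
| trans_SyncR: "trans (Conf S \<rho> P) (ASend c v) (One t) (return_pmf (Conf S \<rho> P')) \<Longrightarrow>
    trans (Conf S \<rho> Q) (ARecv c v) (One t') (return_pmf (Conf S \<rho> Q')) \<Longrightarrow>
    trans (Conf S \<rho> (Par Q P)) ATau (Two t t') (return_pmf (Conf S \<rho> (Par Q' P')))"

inductive trans_bot :: "'t conf option \<Rightarrow> act \<Rightarrow> 't sched \<Rightarrow> 't dist \<Rightarrow> bool" where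
  "trans C \<mu> s \<Theta> \<Longrightarrow> trans_bot (Some C) \<mu> s (map_pmf Some \<Theta>)"
| "(\<nexists>\<Theta>. trans C \<mu> s \<Theta>) \<Longrightarrow> trans_bot (Some C) \<mu> s (return_pmf None)"
| "trans_bot None \<mu> s (return_pmf None)"

text \<open>
  \<open>lift_rel R \<Delta> \<Theta>\<close>: for some finite family of weights \<open>p\<^sub>i\<close>, points \<open>x\<^sub>i\<close> and distributions \<open>\<Theta>\<^sub>i\<close>
  with \<open>R x\<^sub>i \<Theta>\<^sub>i\<close>, we have \<open>\<Delta> = \<Sum>\<^sub>i p\<^sub>i \<bullet> x\<^sub>i\<close> and \<open>\<Theta> = \<Sum>\<^sub>i p\<^sub>i \<bullet> \<Theta>\<^sub>i\<close>. The \<open>x\<^sub>i\<close> may repeat.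
\<close>

definition lift_rel :: "('a \<Rightarrow> 'b pmf \<Rightarrow> bool) \<Rightarrow> 'a pmf \<Rightarrow> 'b pmf \<Rightarrow> bool" where
  "lift_rel R \<Delta> \<Theta> \<longleftrightarrow> (\<exists>(p :: nat pmf) x \<Theta>s. finite (set_pmf p) \<and>
     \<Delta> = map_pmf x p \<and> \<Theta> = bind_pmf p \<Theta>s \<and> (\<forall>i \<in> set_pmf p. R (x i) (\<Theta>s i)))"

definition conf_trans :: "'t conf option \<Rightarrow> act \<Rightarrow> 't sched pmf \<Rightarrow> 't dist \<Rightarrow> bool" where
  "conf_trans C \<mu> \<delta> \<Theta> \<longleftrightarrow> lift_rel (trans_bot C \<mu>) \<delta> \<Theta>"

definition dist_trans :: "'t dist \<Rightarrow> act \<Rightarrow> 't sched pmf \<Rightarrow> 't dist \<Rightarrow> bool" where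
  "dist_trans \<Delta> \<mu> \<delta> \<Theta> \<longleftrightarrow> lift_rel (\<lambda>C. conf_trans C \<mu> \<delta>) \<Delta> \<Theta>"

text \<open>Deterministic tagging is required of \<open>\<Delta>\<close> and of everything reachable from it.\<close>

definition det_tagged :: "'t dist \<Rightarrow> bool" where
  "det_tagged \<Delta> \<longleftrightarrow> (\<forall>\<Theta>. (\<lambda>\<Delta> \<Delta>'. \<exists>\<mu> \<delta>. dist_trans \<Delta> \<mu> \<delta> \<Delta>')\<^sup>*\<^sup>* \<Delta> \<Theta> \<longrightarrow>
     (\<forall>\<mu> \<delta> \<Theta>' \<Theta>''. dist_trans \<Theta> \<mu> \<delta> \<Theta>' \<longrightarrow> dist_trans \<Theta> \<mu> \<delta> \<Theta>'' \<longrightarrow> \<Theta>' = \<Theta>''))"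


section \<open>Contexts and saturated bisimilarity\<close>

text \<open>\<open>Ctx S Q\<close> is the context \<open>[\<cdot>]\<^sub>S \<parallel> Q\<close>.\<close>

datatype 't ctx = Ctx (hole: "qubit set") (env: "'t proc")

definition ctx_typed :: "qubit set \<Rightarrow> 't ctx \<Rightarrow> bool" where
  "ctx_typed S B \<longleftrightarrow> hole B \<subseteq> S \<and> closed_proc (env B) \<and> qnames (S - hole B) \<turnstile> env B"

definition fill :: "'t ctx \<Rightarrow> 't dist \<Rightarrow> 't dist" where
  "fill B = map_pmf (map_option (map_cproc (\<lambda>P. Par P (env B))))"

text \<open>
  Since all processes under consideration are tagged deterministically, this is required of the
  related distributions, and contexts range over those whose composition with both of them is
  again tagged deterministically (a context reusing a tag of \<open>\<Delta>\<close> or \<open>\<Theta>\<close> need not be).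
  A context of type \<open>U\<close> is applicable at type \<open>(S, S')\<close> if its hole is \<open>S'\<close> and \<open>U \<subseteq> S\<close>.
\<close>

definition sat_bisim :: "('t dist \<Rightarrow> 't dist \<Rightarrow> bool) \<Rightarrow> bool" where
  "sat_bisim R \<longleftrightarrow> (\<forall>\<Delta> \<Theta>. R \<Delta> \<Theta> \<longrightarrow>
     det_tagged \<Delta> \<and> det_tagged \<Theta> \<and>
     (\<exists>S S'. dist_typed S S' \<Delta> \<and> dist_typed S S' \<Theta> \<and>
        mass \<Delta> = mass \<Theta> \<and>
        (\<forall>B U \<delta>. ctx_typed U B \<and> hole B = S' \<and> U \<subseteq> S \<and> finite (set_pmf \<delta>) \<and>
             det_tagged (fill B \<Delta>) \<and> det_tagged (fill B \<Theta>) \<longrightarrow>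
           (\<forall>\<Delta>'. dist_trans (fill B \<Delta>) ATau \<delta> \<Delta>' \<longrightarrow>
              (\<exists>\<Theta>'. dist_trans (fill B \<Theta>) ATau \<delta> \<Theta>' \<and> R \<Delta>' \<Theta>')) \<and>
           (\<forall>\<Theta>'. dist_trans (fill B \<Theta>) ATau \<delta> \<Theta>' \<longrightarrow>
              (\<exists>\<Delta>'. dist_trans (fill B \<Delta>) ATau \<delta> \<Delta>' \<and> R \<Delta>' \<Theta>')))))"

definition sat_bisimilar :: "'t dist \<Rightarrow> 't dist \<Rightarrow> bool" (infix "\<sim>\<^sub>s" 50) where
  "\<Delta> \<sim>\<^sub>s \<Theta> \<longleftrightarrow> (\<exists>R. sat_bisim R \<and> R \<Delta> \<Theta>)"

lemma sat_bisim_sat_bisimilar: "sat_bisim (\<sim>\<^sub>s)"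
  unfolding sat_bisim_def
proof (intro allI impI, goal_cases)
  case (1 \<Delta> \<Theta>)
  then obtain R where R: "sat_bisim R" "R \<Delta> \<Theta>" unfolding sat_bisimilar_def by blast
  have le: "R \<Delta>' \<Theta>' \<longrightarrow> \<Delta>' \<sim>\<^sub>s \<Theta>'" for \<Delta>' \<Theta>' using R(1) unfolding sat_bisimilar_def by blast
  show ?case
    by (rule mp[OF _ R(1)[unfolded sat_bisim_def, rule_format, OF R(2)]])
      (rule imp_refl le conj_mono ex_mono all_mono imp_mono)+
qed

end

theory Submission
  imports Defs
begin

text \<open>
  For \<open>0 < p < 1\<close> the pairs \<open>(\<Delta>\<^sub>1 \<oplus>\<^sub>p \<Delta>\<^sub>2, \<Theta>\<^sub>1 \<oplus>\<^sub>p \<Theta>\<^sub>2)\<close> with \<open>\<Delta>\<^sub>i \<sim>\<^sub>s \<Theta>\<^sub>i\<close> and well-typed left component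
  form a saturated bisimulation. A transition of a mixture is the mixture of transitions of its
  components, so both the matching of steps and deterministic tagging reduce to the components.
  The remaining point is that the mixture of the successors is again well-typed: each successor
  is typed because it is bisimilar to something, and a \<open>\<tau>\<close>-step does not change the register and
  the type of the process, so the types of the two components still agree. Components of mass
  zero are equal to \<open>\<bottom>\<close> and have every type.
\<close>

section \<open>Convex combinations and lifted relations\<close>

lemma pmf_pchoice:
  assumes "p \<in> {0..1}"
  shows "pmf (pchoice p A B) x = p * pmf A x + (1 - p) * pmf B x"
  using assms by (simp add: pchoice_def pmf_bind)

lemma set_pmf_pchoice:
  assumes "0 < p" "p < 1"
  shows "set_pmf (pchoice p A B) = set_pmf A \<union> set_pmf B"
  using assms by (simp add: pchoice_def set_pmf_bernoulli UNIV_bool Un_commute)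

lemma pchoice_commute: "p \<in> {0..1} \<Longrightarrow> pchoice p A B = pchoice (1 - p) B A"
  by (rule pmf_eqI) (simp add: pmf_pchoice)

lemma pchoice_0: "pchoice 0 A B = B"
  by (rule pmf_eqI) (simp add: pmf_pchoice)

lemma pchoice_1: "pchoice 1 A B = A"
  by (rule pmf_eqI) (simp add: pmf_pchoice)

lemma pchoice_left_cancel:
  assumes "0 < p" "p < 1" "pchoice p A B = pchoice p A' B"
  shows "A = A'"
proof (rule pmf_eqI)
  fix x
  have "pmf (pchoice p A B) x = pmf (pchoice p A' B) x" using assms by simp
  then show "pmf A x = pmf A' x" using assms(1,2) by (simp add: pmf_pchoice)
qed

lemma map_pmf_pchoice: "map_pmf f (pchoice p A B) = pchoice p (map_pmf f A) (map_pmf f B)"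
  unfolding pchoice_def map_bind_pmf by (rule bind_pmf_cong) auto

lemma bind_pmf_pchoice: "bind_pmf (pchoice p A B) f = pchoice p (bind_pmf A f) (bind_pmf B f)"
  unfolding pchoice_def bind_assoc_pmf by (rule bind_pmf_cong) auto

text \<open>The definition of \<open>lift_rel\<close> fixes \<open>nat\<close> as index type. A
  finite support of any type embeds there, so families may also be indexed by points or by sum
  types.\<close>

lemma lift_relI:
  fixes q :: "'i pmf"
  assumes fin: "finite (set_pmf q)" and "\<Delta> = map_pmf x q" "\<Theta> = bind_pmf q \<Theta>s"
    and R: "\<And>i. i \<in> set_pmf q \<Longrightarrow> R (x i) (\<Theta>s i)"
  shows "lift_rel R \<Delta> \<Theta>"
proof -
  obtain f :: "'i \<Rightarrow> nat" where f: "inj_on f (set_pmf q)"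
    using finite_imp_inj_to_nat_seg[OF fin] by blast
  let ?g = "inv_into (set_pmf q) f"
  have g: "?g (f i) = i" if "i \<in> set_pmf q" for i
    using f that by simp
  have "\<Delta> = map_pmf (x \<circ> ?g) (map_pmf f q)"
    unfolding assms(2) pmf.map_comp by (rule map_pmf_cong) (auto simp: g)
  moreover have "\<Theta> = bind_pmf (map_pmf f q) (\<Theta>s \<circ> ?g)"
    unfolding assms(3) bind_map_pmf by (rule bind_pmf_cong) (auto simp: g)
  moreover have "\<forall>j \<in> set_pmf (map_pmf f q). R ((x \<circ> ?g) j) ((\<Theta>s \<circ> ?g) j)"
    using R by (auto simp: g)
  moreover have "finite (set_pmf (map_pmf f q))" using fin by simp
  ultimately show ?thesis unfolding lift_rel_def by blast
qed

lemma lift_rel_total: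
  assumes "finite (set_pmf \<Delta>)" "\<And>x. x \<in> set_pmf \<Delta> \<Longrightarrow> \<exists>\<Theta>. R x \<Theta>"
  shows "\<exists>\<Theta>. lift_rel R \<Delta> \<Theta>"
proof -
  obtain F where "\<And>x. x \<in> set_pmf \<Delta> \<Longrightarrow> R x (F x)" using assms(2) by metis
  then have "lift_rel R \<Delta> (bind_pmf \<Delta> F)"
    by (intro lift_relI[of \<Delta> _ id]) (auto simp: assms(1))
  then show ?thesis ..
qed

lemma lift_rel_finite:
  assumes "lift_rel R \<Delta> \<Theta>" "\<And>x \<Theta>'. R x \<Theta>' \<Longrightarrow> finite (set_pmf \<Theta>')"
  shows "finite (set_pmf \<Theta>)"
  using assms unfolding lift_rel_def by fastforce

lemma lift_rel_finite_source: "lift_rel R \<Delta> \<Theta> \<Longrightarrow> finite (set_pmf \<Delta>)"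
  unfolding lift_rel_def by auto

lemma lift_rel_set_pmf:
  assumes "lift_rel R \<Delta> \<Theta>" "y \<in> set_pmf \<Theta>"
  obtains x \<Theta>' where "x \<in> set_pmf \<Delta>" "R x \<Theta>'" "y \<in> set_pmf \<Theta>'"
  using assms unfolding lift_rel_def by fastforce

text \<open>The two index families are put side by side as a disjoint sum and mixed with parameter
  \<open>p\<close>.\<close>

lemma lift_rel_pchoice:
  assumes "lift_rel R A A'" "lift_rel R B B'"
  shows "lift_rel R (pchoice p A B) (pchoice p A' B')"
proof -
  obtain a x As where a: "finite (set_pmf a)" "A = map_pmf x a" "A' = bind_pmf a As"
    "\<forall>i \<in> set_pmf (a :: nat pmf). R (x i) (As i)"
    using assms(1) unfolding lift_rel_def by blast
  obtain b y Bs where b: "finite (set_pmf b)" "B = map_pmf y b" "B' = bind_pmf b Bs"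
    "\<forall>i \<in> set_pmf (b :: nat pmf). R (y i) (Bs i)"
    using assms(2) unfolding lift_rel_def by blast
  let ?q = "pchoice p (map_pmf Inl a) (map_pmf Inr b) :: (nat + nat) pmf"
  have sub: "set_pmf ?q \<subseteq> Inl ` set_pmf a \<union> Inr ` set_pmf b"
    by (auto simp: pchoice_def split: if_splits)
  show ?thesis
  proof (rule lift_relI[of ?q _ "case_sum x y" _ "case_sum As Bs"])
    show "finite (set_pmf ?q)" using sub a(1) b(1) by (meson finite_UnI finite_imageI finite_subset)
    show "pchoice p A B = map_pmf (case_sum x y) ?q"
      by (simp add: map_pmf_pchoice pmf.map_comp a(2) b(2) comp_def)
    show "pchoice p A' B' = bind_pmf ?q (case_sum As Bs)"
      by (simp add: bind_pmf_pchoice bind_map_pmf a(3) b(3))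
    show "R (case_sum x y i) (case_sum As Bs i)" if "i \<in> set_pmf ?q" for i
      using that sub a(4) b(4) by auto
  qed
qed

text \<open>Conversely, splitting each index according to the share its point has in \<open>A\<close> and in \<open>B\<close>
  splits the target.\<close>

lemma lift_rel_pchoiceE:
  assumes "lift_rel R (pchoice p A B) \<Theta>" "0 < p" "p < 1"
  obtains A' B' where "\<Theta> = pchoice p A' B'" "lift_rel R A A'" "lift_rel R B B'"
proof -
  obtain q x \<Theta>s where q: "finite (set_pmf q)" "pchoice p A B = map_pmf x q"
    "\<Theta> = bind_pmf q \<Theta>s" "\<And>i. i \<in> set_pmf (q :: nat pmf) \<Longrightarrow> R (x i) (\<Theta>s i)"
    using assms(1) unfolding lift_rel_def by blast
  \<comment> \<open>\<open>?c c\<close> draws an index among those whose point is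
    \<open>c\<close>.\<close>
  let ?c = "\<lambda>c. cond_pmf q {i. x i = c}"
  \<comment> \<open>Drawing a point and then an index conditioned on it recovers the original index
    distribution.\<close>
  have split: "bind_pmf (pchoice p A B) ?c = q"
    unfolding q(2)
  proof (rule bind_cond_pmf_cancel)
    show "measure (measure_pmf q) {i. x i = c} = measure (measure_pmf (map_pmf x q)) {c. x j = c}"
      if "x j = c" "j \<in> set_pmf q" for c j
    proof -
      have "{i. x i = c} = x -` {c. x j = c}" using that by auto
      then show ?thesis by simp
    qed
  qed auto
  \<comment> \<open>Both weights are positive, so every point of either component has an index and
    conditioning on it is meaningful.\<close>
  have sub: "set_pmf A \<subseteq> x ` set_pmf q" "set_pmf B \<subseteq> x ` set_pmf q"
    using arg_cong[OF q(2), of set_pmf] set_pmf_pchoice[OF assms(2,3), of A B] by auto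
  have part: "lift_rel R D (bind_pmf (bind_pmf D ?c) \<Theta>s)"
    if D: "set_pmf D \<subseteq> x ` set_pmf q" for D
  proof (rule lift_relI[of "bind_pmf D ?c" _ x _ \<Theta>s])
    have c: "set_pmf (?c c) = set_pmf q \<inter> {i. x i = c}" if "c \<in> set_pmf D" for c
      using D that by (intro set_cond_pmf) auto
    then show "finite (set_pmf (bind_pmf D ?c))"
      by (auto intro: finite_subset[OF _ q(1)])
    show "R (x i) (\<Theta>s i)" if "i \<in> set_pmf (bind_pmf D ?c)" for i
      using that c by (intro q(4)) auto
    have "map_pmf x (bind_pmf D ?c) = bind_pmf D (\<lambda>c. map_pmf (\<lambda>_. c) (?c c))"
      unfolding map_bind_pmf by (intro bind_pmf_cong map_pmf_cong) (auto simp: c)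
    then show "D = map_pmf x (bind_pmf D ?c)" by (simp add: bind_return_pmf')
  qed auto
  have "\<Theta> = pchoice p (bind_pmf (bind_pmf A ?c) \<Theta>s) (bind_pmf (bind_pmf B ?c) \<Theta>s)"
    using q(3) by (simp only: bind_pmf_pchoice[symmetric] split)
  with part sub show thesis by (intro that) auto
qed


section \<open>Transitions of distributions\<close>

lemma trans_finite: "trans C \<mu> s \<Theta> \<Longrightarrow> finite (set_pmf \<Theta>)"
proof (induction rule: trans.induct)
  case (trans_Meas M Ms S qs \<rho> t y P)
  \<comment> \<open>Branching comes only from measurements. By the premise of the rule, outcomes
    beyond the list of operators have probability 0.\<close>
  have "set_pmf M \<subseteq> {..<length Ms}"
  proof
    fix m assume "m \<in> set_pmf M"
    then show "m \<in> {..<length Ms}"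
      using trans_Meas[of m] by (auto simp: set_pmf_iff split: if_splits)
  qed
  then show ?case by (simp add: finite_subset)
qed auto

lemma trans_bot_total: "\<exists>\<Theta>. trans_bot C \<mu> s \<Theta>"
  by (cases C) (auto intro: trans_bot.intros)

lemma trans_bot_finite: "trans_bot C \<mu> s \<Theta> \<Longrightarrow> finite (set_pmf \<Theta>)"
  by (induction rule: trans_bot.induct) (auto dest: trans_finite)

text \<open>Steps to bottom enable every scheduler at every configuration, so it suffices to choose
  one target per point.\<close>

lemma dist_trans_total:
  "finite (set_pmf \<Delta>) \<Longrightarrow> finite (set_pmf \<delta>) \<Longrightarrow> \<exists>\<Theta>. dist_trans \<Delta> \<mu> \<delta> \<Theta>"
  unfolding dist_trans_def conf_trans_def by (intro lift_rel_total trans_bot_total) auto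

lemma dist_trans_finite: "dist_trans \<Delta> \<mu> \<delta> \<Theta> \<Longrightarrow> finite (set_pmf \<Theta>)"
  unfolding dist_trans_def conf_trans_def
  by (erule lift_rel_finite, erule lift_rel_finite, erule trans_bot_finite)

text \<open>The nonempty support of the target exhibits a step of a single configuration, and such a
  step exists only for finitely supported schedulers.\<close>

lemma dist_trans_finite_sched:
  assumes "dist_trans \<Delta> \<mu> \<delta> \<Theta>"
  shows "finite (set_pmf \<delta>)"
proof -
  obtain y where "y \<in> set_pmf \<Theta>" using set_pmf_not_empty by fast
  with assms obtain C \<Theta>' where "conf_trans C \<mu> \<delta> \<Theta>'"
    unfolding dist_trans_def by (rule lift_rel_set_pmf)
  then show ?thesis unfolding conf_trans_def by (rule lift_rel_finite_source)
qed

text \<open>Bottom and blocked configurations lead only to bottom, so a live configuration in the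
  target stems from a genuine transition.\<close>

lemma dist_trans_set_pmf:
  assumes "dist_trans \<Delta> \<mu> \<delta> \<Theta>" "Some C' \<in> set_pmf \<Theta>"
  obtains C s \<Theta>' where "Some C \<in> set_pmf \<Delta>" "trans C \<mu> s \<Theta>'" "C' \<in> set_pmf \<Theta>'"
proof -
  obtain X \<Theta>1 where 1: "X \<in> set_pmf \<Delta>" "conf_trans X \<mu> \<delta> \<Theta>1" "Some C' \<in> set_pmf \<Theta>1"
    using assms unfolding dist_trans_def by (rule lift_rel_set_pmf)
  then obtain s \<Theta>2 where "trans_bot X \<mu> s \<Theta>2" "Some C' \<in> set_pmf \<Theta>2"
    unfolding conf_trans_def by (metis lift_rel_set_pmf)
  from this(1) this(2) show thesis using 1(1) by cases (auto intro: that)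
qed

section \<open>Deterministic tagging of mixtures and of their components\<close>

lemma det_tagged_trans:
  assumes "det_tagged \<Delta>" "dist_trans \<Delta> \<mu> \<delta> \<Delta>'"
  shows "det_tagged \<Delta>'"
  unfolding det_tagged_def
proof (intro allI impI)
  fix \<Theta> \<mu>' \<delta>' \<Theta>1 \<Theta>2
  assume "(\<lambda>\<Delta> \<Delta>'. \<exists>\<mu> \<delta>. dist_trans \<Delta> \<mu> \<delta> \<Delta>')\<^sup>*\<^sup>* \<Delta>' \<Theta>"
  then have "(\<lambda>\<Delta> \<Delta>'. \<exists>\<mu> \<delta>. dist_trans \<Delta> \<mu> \<delta> \<Delta>')\<^sup>*\<^sup>* \<Delta> \<Theta>"
    using assms(2) by (intro converse_rtranclp_into_rtranclp[of _ \<Delta> \<Delta>']) auto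
  then show "dist_trans \<Theta> \<mu>' \<delta>' \<Theta>1 \<Longrightarrow> dist_trans \<Theta> \<mu>' \<delta>' \<Theta>2 \<Longrightarrow> \<Theta>1 = \<Theta>2"
    using assms(1) unfolding det_tagged_def by blast
qed

lemma det_tagged_unique:
  assumes "det_tagged \<Delta>" "dist_trans \<Delta> \<mu> \<delta> \<Theta>" "dist_trans \<Delta> \<mu> \<delta> \<Theta>'"
  shows "\<Theta> = \<Theta>'"
  using assms unfolding det_tagged_def by blast

text \<open>Induction on reachability spreads \<open>P\<close> along all steps, so an invariant can
  replace the reachable set.\<close>

lemma det_tagged_coinduct:
  assumes "P \<Delta>"
    and step: "\<And>\<Delta> \<mu> \<delta> \<Delta>'. P \<Delta> \<Longrightarrow> dist_trans \<Delta> \<mu> \<delta> \<Delta>' \<Longrightarrow> P \<Delta>'"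
    and det: "\<And>\<Delta> \<mu> \<delta> \<Theta> \<Theta>'. P \<Delta> \<Longrightarrow> dist_trans \<Delta> \<mu> \<delta> \<Theta> \<Longrightarrow> dist_trans \<Delta> \<mu> \<delta> \<Theta>' \<Longrightarrow> \<Theta> = \<Theta>'"
  shows "det_tagged \<Delta>"
proof -
  have "P \<Theta>" if "(\<lambda>\<Delta> \<Delta>'. \<exists>\<mu> \<delta>. dist_trans \<Delta> \<mu> \<delta> \<Delta>')\<^sup>*\<^sup>* \<Delta> \<Theta>" for \<Theta>
    using that by induction (use assms(1) step in blast)+
  then show ?thesis unfolding det_tagged_def using det by blast
qed

text \<open>A step of the mixture splits into steps of the components under the same scheduler, and
  those have unique targets.\<close>

lemma det_tagged_pchoice:
  assumes "det_tagged A" "det_tagged B" and p: "0 < p" "p < 1"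
  shows "det_tagged (pchoice p A B)"
proof (rule det_tagged_coinduct)
  let ?P = "\<lambda>\<Delta>. \<exists>A B. \<Delta> = pchoice p A B \<and> det_tagged A \<and> det_tagged B"
  show "?P (pchoice p A B)" using assms by blast
  show "?P \<Delta>'" if \<Delta>: "?P \<Delta>" and tr: "dist_trans \<Delta> \<mu> \<delta> \<Delta>'" for \<Delta> \<mu> \<delta> \<Delta>'
  proof -
    obtain A B where \<Delta>: "\<Delta> = pchoice p A B" "det_tagged A" "det_tagged B" using \<Delta> by blast
    obtain A' B' where "\<Delta>' = pchoice p A' B'" "dist_trans A \<mu> \<delta> A'" "dist_trans B \<mu> \<delta> B'"
      using tr p unfolding \<Delta>(1) dist_trans_def by (rule lift_rel_pchoiceE)
    with \<Delta> show ?thesis using det_tagged_trans by blast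
  qed
  show "\<Theta> = \<Theta>'" if \<Delta>: "?P \<Delta>" and tr: "dist_trans \<Delta> \<mu> \<delta> \<Theta>" "dist_trans \<Delta> \<mu> \<delta> \<Theta>'"
    for \<Delta> \<mu> \<delta> \<Theta> \<Theta>'
  proof -
    obtain A B where \<Delta>: "\<Delta> = pchoice p A B" "det_tagged A" "det_tagged B" using \<Delta> by blast
    obtain A1 B1 where 1: "\<Theta> = pchoice p A1 B1" "dist_trans A \<mu> \<delta> A1" "dist_trans B \<mu> \<delta> B1"
      using tr(1) p unfolding \<Delta>(1) dist_trans_def by (rule lift_rel_pchoiceE)
    obtain A2 B2 where 2: "\<Theta>' = pchoice p A2 B2" "dist_trans A \<mu> \<delta> A2" "dist_trans B \<mu> \<delta> B2"
      using tr(2) p unfolding \<Delta>(1) dist_trans_def by (rule lift_rel_pchoiceE)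
    show ?thesis using 1 2 \<Delta>(2,3) det_tagged_unique by blast
  qed
qed

text \<open>Finiteness of \<open>B\<close> ensures that \<open>B\<close> can match every step of \<open>A\<close>.\<close>

lemma det_tagged_pchoiceD1:
  assumes "det_tagged (pchoice p A B)" "finite (set_pmf B)" and p: "0 < p" "p < 1"
  shows "det_tagged A"
proof (rule det_tagged_coinduct)
  let ?P = "\<lambda>A. \<exists>B. finite (set_pmf B) \<and> det_tagged (pchoice p A B)"
  show "?P A" using assms by blast
  \<comment> \<open>One \<open>B'\<close> serves all targets of \<open>A\<close>: two steps of
    \<open>A\<close> then give mixtures with the same second component, which
    \<open>pchoice_left_cancel\<close> removes.\<close>
  have ex: "\<exists>B'. finite (set_pmf B') \<and>
      (\<forall>A'. dist_trans A \<mu> \<delta> A' \<longrightarrow> dist_trans (pchoice p A B) \<mu> \<delta> (pchoice p A' B'))"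
    if "finite (set_pmf B)" "dist_trans A \<mu> \<delta> A'" for A B \<mu> \<delta> A'
    using dist_trans_total[OF that(1) dist_trans_finite_sched[OF that(2)]] dist_trans_finite
      lift_rel_pchoice unfolding dist_trans_def by metis
  show "?P A'" if "?P A" "dist_trans A \<mu> \<delta> A'" for A \<mu> \<delta> A'
    using that ex det_tagged_trans by metis
  show "\<Theta> = \<Theta>'" if "?P A" "dist_trans A \<mu> \<delta> \<Theta>" "dist_trans A \<mu> \<delta> \<Theta>'" for A \<mu> \<delta> \<Theta> \<Theta>'
    using that ex det_tagged_unique pchoice_left_cancel[OF p] by metis
qed

lemma det_tagged_pchoice_iff:
  assumes "finite (set_pmf A)" "finite (set_pmf B)" "0 < p" "p < 1"
  shows "det_tagged (pchoice p A B) \<longleftrightarrow> det_tagged A \<and> det_tagged B"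
  using assms det_tagged_pchoice[of A B p] det_tagged_pchoiceD1[of p A B]
    det_tagged_pchoiceD1[of "1 - p" B A] pchoice_commute[of p A B] by auto


section \<open>Preservation of process types\<close>

text \<open>Unlike \<open>qnames\<close>, this also contains the quantum variables that occur in the type of a
  process below a quantum reception.\<close>

definition qexprs :: "expr set" where
  "qexprs = range (\<lambda>q. EVal (VQubit q)) \<union> EVar ` {x. var_ty x = TQubit}"

lemma qnames_subset_qexprs: "qnames S \<subseteq> qexprs"
  by (auto simp: qnames_def qexprs_def)

lemma qnames_inj: "qnames S = qnames S' \<longleftrightarrow> S = S'"
  unfolding qnames_def by (rule inj_image_eq_iff) (simp add: inj_on_def)

section \<open>Substitution of values and typing\<close>

lemma subst_expr_qexprs: "e \<in> qexprs \<Longrightarrow> e \<noteq> EVar x \<Longrightarrow> subst_expr v x e = e"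
  by (auto simp: qexprs_def split: if_splits)

lemma subst_expr_typed: "expr_typed e T \<Longrightarrow> val_ty v = var_ty x \<Longrightarrow> expr_typed (subst_expr v x e) T"
proof (induction rule: expr_typed.induct)
  case (1 y)
  then show ?case using expr_typed.intros(1)[of y] expr_typed.intros(2)[of v] by auto
qed (auto intro: expr_typed.intros)

lemma subst_expr_image_id: "\<Sigma> \<subseteq> qexprs \<Longrightarrow> EVar x \<notin> \<Sigma> \<Longrightarrow> subst_expr v x ` \<Sigma> = \<Sigma>"
  by (force simp: image_def dest: subst_expr_qexprs[of _ x v])

lemma inj_on_map_enum:
  assumes "inj_on f A" "distinct xs" "set xs \<subseteq> A"
  shows "distinct (map f xs)" "set (map f xs) \<subseteq> f ` A"
  using assms by (auto simp: distinct_map image_mono intro: inj_on_subset)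

text \<open>Substitution acts on the owned names by \<open>subst_expr v x\<close>. Injectivity
  prevents two of them from merging, which preserves distinct argument lists, disjointness in
  parallel composition and the removal of a sent name.\<close>

lemma subst_typed:
  assumes "\<Sigma> \<turnstile> P" "\<Sigma> \<subseteq> qexprs" "inj_on (subst_expr v x) \<Sigma>" "val_ty v = var_ty x"
  shows "subst_expr v x ` \<Sigma> \<turnstile> subst v x P"
  using assms
proof (induction rule: proc_typed.induct)
  case (typed_Discard es \<Sigma>)
  then show ?case by (auto intro!: proc_typed.typed_Discard simp: distinct_map)
next
  case (typed_Sop es \<Sigma> Es P t)
  then show ?case using inj_on_map_enum[of "subst_expr v x" \<Sigma> es]
    by (simp add: proc_typed.typed_Sop)
next
  case (typed_Meas es \<Sigma> Ms y P t)
  have "subst_expr v x ` \<Sigma> \<turnstile> (if y = x then P else subst v x P)"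
  proof (cases "y = x")
    case True
    \<comment> \<open>The binder has a classical type, whereas variables in \<Sigma> are quantum.
      Hence the substitution, which stops at the binder, also fixes \<Sigma>.\<close>
    then have "EVar x \<notin> \<Sigma>" using typed_Meas by (auto simp: qexprs_def)
    then show ?thesis using True typed_Meas by (simp add: subst_expr_image_id)
  qed (use typed_Meas in simp)
  then show ?case using typed_Meas inj_on_map_enum[of "subst_expr v x" \<Sigma> es]
    by (simp add: proc_typed.typed_Meas)
next
  case (typed_CRecv c y \<Sigma> P t)
  have "subst_expr v x ` \<Sigma> \<turnstile> (if y = x then P else subst v x P)"
  proof (cases "y = x")
    case True
    then have "EVar x \<notin> \<Sigma>" using typed_CRecv by (auto simp: qexprs_def)
    then show ?thesis using True typed_CRecv by (simp add: subst_expr_image_id)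
  qed (use typed_CRecv in simp)
  then show ?case using typed_CRecv by (auto intro!: proc_typed.typed_CRecv)
next
  case (typed_QRecv c y \<Sigma> P t)
  show ?case
  proof (cases "y = x")
    case True
    then show ?thesis using typed_QRecv
      by (auto intro!: proc_typed.typed_QRecv simp: subst_expr_image_id)
  next
    case False
    \<comment> \<open>\<open>v\<close> is a value, so only \<open>EVar y\<close> itself could be
      mapped to \<open>EVar y\<close>; the side condition of quantum reception survives.\<close>
    have fresh: "EVar y \<notin> subst_expr v x ` \<Sigma>"
    proof
      assume "EVar y \<in> subst_expr v x ` \<Sigma>"
      then obtain e where e: "e \<in> \<Sigma>" "subst_expr v x e = EVar y" by force
      then have "e = EVar y" using typed_QRecv.prems(1)
        by (auto simp: qexprs_def split: if_splits)
      with e typed_QRecv.hyps show False by simp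
    qed
    have "inj_on (subst_expr v x) (\<Sigma> \<union> {EVar y})"
      using typed_QRecv.prems(2) fresh False by auto
    moreover have "\<Sigma> \<union> {EVar y} \<subseteq> qexprs"
      using typed_QRecv by (auto simp: qexprs_def)
    ultimately have "subst_expr v x ` \<Sigma> \<union> {EVar y} \<turnstile> subst v x P"
      using typed_QRecv.IH typed_QRecv.prems(3) False by simp
    then show ?thesis using False fresh typed_QRecv by (auto intro!: proc_typed.typed_QRecv)
  qed
next
  case (typed_CSend c e \<Sigma> P t)
  then show ?case by (auto intro!: proc_typed.typed_CSend subst_expr_typed)
next
  case (typed_QSend c e \<Sigma> P t)
  have "subst_expr v x ` (\<Sigma> - {e}) \<turnstile> subst v x P"
    using typed_QSend by (auto intro: inj_on_subset)
  moreover have "subst_expr v x ` (\<Sigma> - {e}) = subst_expr v x ` \<Sigma> - {subst_expr v x e}"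
    using typed_QSend by (auto simp: inj_on_def)
  ultimately show ?case using typed_QSend
    by (auto intro!: proc_typed.typed_QSend subst_expr_typed)
next
  case (typed_Cond e \<Sigma> P Q)
  then show ?case by (auto intro!: proc_typed.typed_Cond subst_expr_typed)
next
  case (typed_Par \<Sigma>1 \<Sigma>2 P Q)
  then have "subst_expr v x ` \<Sigma>1 \<turnstile> subst v x P" "subst_expr v x ` \<Sigma>2 \<turnstile> subst v x Q"
    by (auto intro: inj_on_subset)
  moreover have "subst_expr v x ` \<Sigma>1 \<inter> subst_expr v x ` \<Sigma>2 = {}"
    using typed_Par.hyps(1) typed_Par.prems(2) by (fastforce simp: inj_on_def)
  ultimately show ?case by (auto simp: image_Un intro: proc_typed.typed_Par)
qed (auto intro: proc_typed.intros)

section \<open>Transfer of qubit ownership along transitions\<close>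

lemma proc_type_eq: "\<Sigma> \<turnstile> P \<Longrightarrow> proc_type P = \<Sigma>"
  unfolding proc_type_def by (rule the_equality, assumption, erule proc_typed_unique)

fun act_type :: "act \<Rightarrow> expr set \<Rightarrow> expr set" where
  "act_type ATau \<Sigma> = \<Sigma>"
| "act_type (ASend c v) \<Sigma> = (if chan_ty c = TQubit then \<Sigma> - {EVal v} else \<Sigma>)"
| "act_type (ARecv c v) \<Sigma> = (if chan_ty c = TQubit then \<Sigma> \<union> {EVal v} else \<Sigma>)"

text \<open>A received qubit has to be fresh, which is not enforced by the reception rule itself but only
  by the parallel contexts in which it is used.\<close>

fun act_fresh :: "act \<Rightarrow> expr set \<Rightarrow> bool" where
  "act_fresh (ARecv c v) \<Sigma> \<longleftrightarrow> (chan_ty c = TQubit \<longrightarrow> EVal v \<notin> \<Sigma>)"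
| "act_fresh _ \<Sigma> \<longleftrightarrow> True"

text \<open>Counterpart of \<open>act_fresh\<close>: freshness is assumed of a receiver, ownership
  is derived for a sender.\<close>

fun act_owned :: "act \<Rightarrow> expr set \<Rightarrow> bool" where
  "act_owned (ASend c v) \<Sigma> \<longleftrightarrow> (chan_ty c = TQubit \<longrightarrow> EVal v \<in> \<Sigma>)"
| "act_owned _ \<Sigma> \<longleftrightarrow> True"

text \<open>Variables do not evaluate and a qubit name evaluates to itself. This identifies the
  qubit sent with the name removed from the type.\<close>

lemma eval_qexprs: "e \<in> qexprs \<Longrightarrow> e \<Down> v \<Longrightarrow> e = EVal v"
  by (auto simp: qexprs_def elim: eval.cases)

text \<open>A sent qubit lies in \<Sigma>1, hence outside \<Sigma>2, and the side condition keeps a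
  received one outside \<Sigma>2; the passive component is unaffected.\<close>

lemma act_type_Par:
  assumes "\<Sigma>1 \<inter> \<Sigma>2 = {}" "act_owned \<mu> \<Sigma>1" "\<forall>c v. \<mu> = ARecv c v \<longrightarrow> EVal v \<notin> \<Sigma>2"
  shows "act_type \<mu> (\<Sigma>1 \<union> \<Sigma>2) = act_type \<mu> \<Sigma>1 \<union> \<Sigma>2" "act_type \<mu> \<Sigma>1 \<inter> \<Sigma>2 = {}"
  using assms by (cases \<mu>; auto)+

lemma act_fresh_mono: "act_fresh \<mu> \<Sigma> \<Longrightarrow> \<Sigma>' \<subseteq> \<Sigma> \<Longrightarrow> act_fresh \<mu> \<Sigma>'"
  by (cases \<mu>) auto

lemma act_owned_mono: "act_owned \<mu> \<Sigma>' \<Longrightarrow> \<Sigma>' \<subseteq> \<Sigma> \<Longrightarrow> act_owned \<mu> \<Sigma>"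
  by (cases \<mu>) auto

text \<open>Subject reduction for all actions, since a synchronisation is built from a send and a
  receive. Ownership belongs to the conclusion because it supplies the receiver's freshness
  there.\<close>

lemma trans_typed:
  assumes "trans C \<mu> s \<Theta>" "\<Sigma> \<turnstile> cproc C" "\<Sigma> \<subseteq> qexprs" "act_fresh \<mu> \<Sigma>"
  shows "act_owned \<mu> \<Sigma> \<and> (\<forall>C' \<in> set_pmf \<Theta>. reg C' = reg C \<and> act_type \<mu> \<Sigma> \<turnstile> cproc C')"
  using assms
proof (induction arbitrary: \<Sigma> rule: trans.induct)
  case (trans_Send e v S \<rho> t c P)
  from trans_Send.prems(1) have ty: "\<Sigma> \<turnstile> Send t c e P" by simp
  show ?case
  proof (cases "chan_ty c = TQubit")
    case True
    with ty have "e \<in> \<Sigma>" "\<Sigma> - {e} \<turnstile> P" by (auto elim: typedE(7))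
    moreover from this have "e = EVal v" using trans_Send eval_qexprs by blast
    ultimately show ?thesis using True by simp
  next
    case False
    with ty show ?thesis by (auto elim: typedE(7))
  qed
next
  case (trans_Recv v c S \<rho> t x P)
  from trans_Recv.prems(1) have ty: "\<Sigma> \<turnstile> Recv t c x P" by simp
  show ?case
  proof (cases "chan_ty c = TQubit")
    case True
    with ty have x: "var_ty x = TQubit" "EVar x \<notin> \<Sigma>" "\<Sigma> \<union> {EVar x} \<turnstile> P"
      by (auto elim: typedE(5))
    have id: "subst_expr v x e = e" if "e \<in> \<Sigma>" for e
      using that x(2) trans_Recv.prems(2) by (intro subst_expr_qexprs) auto
    have image: "subst_expr v x ` \<Sigma> = \<Sigma>" using id by simp
    have "inj_on (subst_expr v x) \<Sigma>" using id by (simp add: inj_on_def)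
    \<comment> \<open>By freshness, the image \<open>EVal v\<close> of \<open>EVar x\<close> differs
      from all members of \<Sigma>.\<close>
    then have "inj_on (subst_expr v x) (\<Sigma> \<union> {EVar x})"
      using trans_Recv.prems(3) True image by auto
    moreover have "\<Sigma> \<union> {EVar x} \<subseteq> qexprs"
      using trans_Recv.prems(2) x(1) by (auto simp: qexprs_def)
    ultimately have "subst_expr v x ` (\<Sigma> \<union> {EVar x}) \<turnstile> subst v x P"
      using trans_Recv.hyps(1) True x by (intro subst_typed) auto
    then show ?thesis using True image by simp
  next
    case False
    with ty have x: "var_ty x = chan_ty c" "\<Sigma> \<turnstile> P" by (auto elim: typedE(5))
    then have fresh: "EVar x \<notin> \<Sigma>" using False trans_Recv.prems(2) by (auto simp: qexprs_def)
    then have "\<And>e. e \<in> \<Sigma> \<Longrightarrow> subst_expr v x e = e"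
      using trans_Recv.prems(2) by (intro subst_expr_qexprs) auto
    then have "inj_on (subst_expr v x) \<Sigma>" by (simp add: inj_on_def)
    then have "subst_expr v x ` \<Sigma> \<turnstile> subst v x P"
      using trans_Recv x by (intro subst_typed) auto
    then show ?thesis using False fresh trans_Recv.prems(2) by (simp add: subst_expr_image_id)
  qed
next
  case (trans_Meas M Ms S qs \<rho> t y P)
  then have y: "var_ty y = TNat" "\<Sigma> \<turnstile> P" by (auto elim: typedE(4))
  then have fresh: "EVar y \<notin> \<Sigma>" using trans_Meas.prems(2) by (auto simp: qexprs_def)
  then have "\<And>e m. e \<in> \<Sigma> \<Longrightarrow> subst_expr (VNat m) y e = e"
    using trans_Meas.prems(2) by (intro subst_expr_qexprs) auto
  then have "\<And>m. inj_on (subst_expr (VNat m) y) \<Sigma>" by (simp add: inj_on_def)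
  then have "\<And>m. subst_expr (VNat m) y ` \<Sigma> \<turnstile> subst (VNat m) y P"
    using trans_Meas.prems(2) y by (intro subst_typed) auto
  then show ?case using fresh trans_Meas.prems(2) by (auto simp: subst_expr_image_id)
next
  case (trans_CondT e S \<rho> P \<mu> s \<Theta> Q)
  then show ?case by (auto elim!: typedE(8))
next
  case (trans_CondF e S \<rho> Q \<mu> s \<Theta> P)
  then show ?case by (auto elim!: typedE(8))
next
  case (trans_SumL S \<rho> P \<mu> s \<Theta> Q)
  then show ?case by (auto elim!: typedE(9))
next
  case (trans_SumR S \<rho> Q \<mu> s \<Theta> P)
  then show ?case by (auto elim!: typedE(9))
next
  case (trans_Restr S \<rho> P \<mu> s \<Theta> c)
  then have "\<Sigma> \<turnstile> P" by (auto elim: typedE(11))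
  with trans_Restr show ?case by (auto simp: map_cproc_def intro: proc_typed.typed_Restr)
next
  case (trans_ParL S \<rho> P \<mu> s \<Theta> Q)
  from trans_ParL.prems(1) obtain \<Sigma>1 \<Sigma>2 where
    \<Sigma>: "\<Sigma> = \<Sigma>1 \<union> \<Sigma>2" "\<Sigma>1 \<inter> \<Sigma>2 = {}" "\<Sigma>1 \<turnstile> P" "\<Sigma>2 \<turnstile> Q" by (auto elim: typedE(10))
  have IH: "act_owned \<mu> \<Sigma>1" "\<And>C'. C' \<in> set_pmf \<Theta> \<Longrightarrow> reg C' = S \<and> act_type \<mu> \<Sigma>1 \<turnstile> cproc C'"
    using trans_ParL.IH[of \<Sigma>1] trans_ParL.prems(2) act_fresh_mono[OF trans_ParL.prems(3), of \<Sigma>1] \<Sigma>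
    by auto
  \<comment> \<open>Uniqueness of types makes \<open>proc_type Q\<close> equal to \<Sigma>2, which
    turns the side condition of the rule into that of \<open>act_type_Par\<close>.\<close>
  have "act_type \<mu> \<Sigma> = act_type \<mu> \<Sigma>1 \<union> \<Sigma>2" "act_type \<mu> \<Sigma>1 \<inter> \<Sigma>2 = {}"
    using act_type_Par[of \<Sigma>1 \<Sigma>2 \<mu>] \<Sigma> IH(1) trans_ParL.hyps(2) by (auto simp: proc_type_eq)
  then show ?case using IH \<Sigma> act_owned_mono[OF IH(1), of \<Sigma>]
    by (auto simp: map_cproc_def intro!: proc_typed.typed_Par)
next
  case (trans_ParR S \<rho> Q \<mu> s \<Theta> P)
  from trans_ParR.prems(1) obtain \<Sigma>1 \<Sigma>2 where
    \<Sigma>: "\<Sigma> = \<Sigma>1 \<union> \<Sigma>2" "\<Sigma>1 \<inter> \<Sigma>2 = {}" "\<Sigma>1 \<turnstile> P" "\<Sigma>2 \<turnstile> Q" by (auto elim: typedE(10))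
  have IH: "act_owned \<mu> \<Sigma>2" "\<And>C'. C' \<in> set_pmf \<Theta> \<Longrightarrow> reg C' = S \<and> act_type \<mu> \<Sigma>2 \<turnstile> cproc C'"
    using trans_ParR.IH[of \<Sigma>2] trans_ParR.prems(2) act_fresh_mono[OF trans_ParR.prems(3), of \<Sigma>2] \<Sigma>
    by auto
  have "act_type \<mu> \<Sigma> = \<Sigma>1 \<union> act_type \<mu> \<Sigma>2" "\<Sigma>1 \<inter> act_type \<mu> \<Sigma>2 = {}"
    using act_type_Par[of \<Sigma>2 \<Sigma>1 \<mu>] \<Sigma> IH(1) trans_ParR.hyps(2)
    by (auto simp: proc_type_eq Un_commute Int_commute)
  then show ?case using IH \<Sigma> act_owned_mono[OF IH(1), of \<Sigma>]
    by (auto simp: map_cproc_def intro!: proc_typed.typed_Par)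
next
  case (trans_SyncL S \<rho> P c v t P' Q t' Q')
  from trans_SyncL.prems(1) obtain \<Sigma>1 \<Sigma>2 where
    \<Sigma>: "\<Sigma> = \<Sigma>1 \<union> \<Sigma>2" "\<Sigma>1 \<inter> \<Sigma>2 = {}" "\<Sigma>1 \<turnstile> P" "\<Sigma>2 \<turnstile> Q" by (auto elim: typedE(10))
  have P: "act_owned (ASend c v) \<Sigma>1" "act_type (ASend c v) \<Sigma>1 \<turnstile> P'"
    using trans_SyncL.IH(1)[of \<Sigma>1] trans_SyncL.prems(2) \<Sigma> by auto
  \<comment> \<open>The sender owns a transmitted qubit, so disjointness makes it fresh for the
    receiver; the action \<open>ATau\<close> gives no freshness.\<close>
  have "act_fresh (ARecv c v) \<Sigma>2" using P(1) \<Sigma>(2) by auto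
  then have Q: "act_type (ARecv c v) \<Sigma>2 \<turnstile> Q'"
    using trans_SyncL.IH(2)[of \<Sigma>2] trans_SyncL.prems(2) \<Sigma> by auto
  have "act_type (ASend c v) \<Sigma>1 \<inter> act_type (ARecv c v) \<Sigma>2 = {}" using \<Sigma>(2) by auto
  from proc_typed.typed_Par[OF this P(2) Q]
  have "act_type (ASend c v) \<Sigma>1 \<union> act_type (ARecv c v) \<Sigma>2 \<turnstile> Par P' Q'" .
  \<comment> \<open>A transmitted qubit merely changes sides.\<close>
  moreover have "act_type (ASend c v) \<Sigma>1 \<union> act_type (ARecv c v) \<Sigma>2 = \<Sigma>"
    using P(1) \<Sigma>(1) by auto
  ultimately show ?case by simp
next
  case (trans_SyncR S \<rho> P c v t P' Q t' Q')
  from trans_SyncR.prems(1) obtain \<Sigma>1 \<Sigma>2 where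
    \<Sigma>: "\<Sigma> = \<Sigma>2 \<union> \<Sigma>1" "\<Sigma>2 \<inter> \<Sigma>1 = {}" "\<Sigma>1 \<turnstile> P" "\<Sigma>2 \<turnstile> Q" by (auto elim: typedE(10))
  have P: "act_owned (ASend c v) \<Sigma>1" "act_type (ASend c v) \<Sigma>1 \<turnstile> P'"
    using trans_SyncR.IH(1)[of \<Sigma>1] trans_SyncR.prems(2) \<Sigma> by auto
  have "act_fresh (ARecv c v) \<Sigma>2" using P(1) \<Sigma>(2) by auto
  then have Q: "act_type (ARecv c v) \<Sigma>2 \<turnstile> Q'"
    using trans_SyncR.IH(2)[of \<Sigma>2] trans_SyncR.prems(2) \<Sigma> by auto
  have "act_type (ARecv c v) \<Sigma>2 \<inter> act_type (ASend c v) \<Sigma>1 = {}" using \<Sigma>(2) by auto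
  from proc_typed.typed_Par[OF this Q P(2)]
  have "act_type (ARecv c v) \<Sigma>2 \<union> act_type (ASend c v) \<Sigma>1 \<turnstile> Par Q' P'" .
  moreover have "act_type (ARecv c v) \<Sigma>2 \<union> act_type (ASend c v) \<Sigma>1 = \<Sigma>"
    using P(1) \<Sigma>(1) by auto
  ultimately show ?case by simp
qed (auto elim: typedE)

text \<open>The context adds \<open>U - S'\<close> to the owned qubits, so the filled process has
  type \<open>qnames U\<close>, which silent steps preserve.\<close>

lemma fill_trans_typed:
  assumes \<Delta>: "dist_typed S S' \<Delta>" and B: "ctx_typed U B" "hole B = S'"
    and tr: "dist_trans (fill B \<Delta>) ATau \<delta> \<Delta>'" and C': "Some C' \<in> set_pmf \<Delta>'"
  shows "reg C' = S" "qnames U \<turnstile> cproc C'"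
proof -
  obtain C s \<Theta> where C: "Some C \<in> set_pmf (fill B \<Delta>)" "trans C ATau s \<Theta>" "C' \<in> set_pmf \<Theta>"
    using tr C' by (rule dist_trans_set_pmf)
  obtain C0 where C0: "Some C0 \<in> set_pmf \<Delta>" "C = map_cproc (\<lambda>P. Par P (env B)) C0"
    using C(1) by (auto simp: fill_def map_option_case split: option.splits)
  have typed: "reg C0 = S" "qnames S' \<turnstile> cproc C0"
    using \<Delta> C0(1) by (auto simp: dist_typed_def conf_typed_def)
  have "qnames S' \<inter> qnames (U - S') = {}" "qnames S' \<union> qnames (U - S') = qnames U"
    using B by (auto simp: qnames_def ctx_typed_def)
  then have "qnames U \<turnstile> cproc C"
    using proc_typed.typed_Par[OF _ typed(2), of "qnames (U - S')" "env B"] B C0(2)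
    by (simp add: ctx_typed_def map_cproc_def)
  from trans_typed[OF C(2) this qnames_subset_qexprs] C(3)
  show "reg C' = S" "qnames U \<turnstile> cproc C'" using typed(1) C0(2) by (auto simp: map_cproc_def)
qed


section \<open>Saturated bisimilarity\<close>

text \<open>One half of the transfer clause; the other half is its instance at the converse
  relation, so symmetric relations need only one proof.\<close>

definition sat_step ::
    "('t dist \<Rightarrow> 't dist \<Rightarrow> bool) \<Rightarrow> qubit set \<Rightarrow> qubit set \<Rightarrow> 't dist \<Rightarrow> 't dist \<Rightarrow> bool" where
  "sat_step R S S' \<Delta> \<Theta> \<longleftrightarrow> (\<forall>B U \<delta>. ctx_typed U B \<and> hole B = S' \<and> U \<subseteq> S \<and>
     finite (set_pmf \<delta>) \<and> det_tagged (fill B \<Delta>) \<and> det_tagged (fill B \<Theta>) \<longrightarrow>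
     (\<forall>\<Delta>'. dist_trans (fill B \<Delta>) ATau \<delta> \<Delta>' \<longrightarrow>
       (\<exists>\<Theta>'. dist_trans (fill B \<Theta>) ATau \<delta> \<Theta>' \<and> R \<Delta>' \<Theta>')))"

lemma sat_bisim_iff:
  "sat_bisim R \<longleftrightarrow> (\<forall>\<Delta> \<Theta>. R \<Delta> \<Theta> \<longrightarrow> det_tagged \<Delta> \<and> det_tagged \<Theta> \<and>
     (\<exists>S S'. dist_typed S S' \<Delta> \<and> dist_typed S S' \<Theta> \<and> mass \<Delta> = mass \<Theta> \<and>
        sat_step R S S' \<Delta> \<Theta> \<and> sat_step R\<inverse>\<inverse> S S' \<Theta> \<Delta>))"
  unfolding sat_bisim_def sat_step_def conversep_iff
  by (simp only: all_conj_distrib imp_conjR conj_ac)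

lemma sat_bisimilar_sym:
  assumes "\<Delta> \<sim>\<^sub>s \<Theta>"
  shows "\<Theta> \<sim>\<^sub>s \<Delta>"
proof -
  have "sat_bisim (\<sim>\<^sub>s)\<inverse>\<inverse>"
    using sat_bisim_sat_bisimilar unfolding sat_bisim_iff conversep_conversep conversep_iff
    by metis
  with assms show ?thesis unfolding sat_bisimilar_def[of \<Theta>] by blast
qed

lemma sat_bisimilarE:
  assumes "\<Delta> \<sim>\<^sub>s \<Theta>"
  obtains S S' where "det_tagged \<Delta>" "det_tagged \<Theta>" "dist_typed S S' \<Delta>" "dist_typed S S' \<Theta>"
    "mass \<Delta> = mass \<Theta>" "sat_step (\<sim>\<^sub>s) S S' \<Delta> \<Theta>"
  using sat_bisim_sat_bisimilar assms unfolding sat_bisim_iff by metis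

section \<open>Mass and types of distributions\<close>

lemma mass_0_iff: "mass \<Delta> = 0 \<longleftrightarrow> \<Delta> = return_pmf None"
proof
  assume "mass \<Delta> = 0"
  then have "measure (measure_pmf \<Delta>) {None} = 1" by (simp add: mass_def measure_pmf_single)
  then have "set_pmf \<Delta> \<subseteq> {None}" by (simp add: measure_pmf.prob_eq_1 AE_measure_pmf_iff subset_eq)
  then show "\<Delta> = return_pmf None" by (simp add: set_pmf_subset_singleton)
qed (simp add: mass_def)

lemma mass_nonzeroE:
  assumes "mass \<Delta> \<noteq> 0"
  obtains C where "Some C \<in> set_pmf \<Delta>"
proof -
  have "\<not> set_pmf \<Delta> \<subseteq> {None}" using assms by (simp add: mass_0_iff set_pmf_subset_singleton)
  then show thesis using that by (metis insertI1 option.exhaust subsetI)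
qed

text \<open>Nonzero mass provides a live configuration, which fixes the register and, by uniqueness
  of process types, the owned qubits.\<close>

lemma dist_typed_unique:
  assumes "dist_typed S S' \<Delta>" "dist_typed T T' \<Delta>" "mass \<Delta> \<noteq> 0"
  shows "S = T" "S' = T'"
proof -
  obtain C where "Some C \<in> set_pmf \<Delta>" using assms(3) by (rule mass_nonzeroE)
  with assms(1,2) have "conf_typed S S' C" "conf_typed T T' C" by (auto simp: dist_typed_def)
  then show "S = T" "S' = T'"
    by (auto simp: conf_typed_def qnames_inj dest: proc_typed_unique)
qed

lemma dist_typed_None: "dist_typed S S' (return_pmf None)"
  by (simp add: dist_typed_def)

text \<open>Bisimilar distributions share some type. For nonzero mass it must be the given one; for
  mass zero both are bottom, which has every type.\<close>

lemma sat_bisimilar_typed: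
  assumes "\<Delta> \<sim>\<^sub>s \<Theta>" "dist_typed S S' \<Delta>"
  shows "dist_typed S S' \<Theta>"
proof -
  obtain T T' where T: "dist_typed T T' \<Delta>" "dist_typed T T' \<Theta>" "mass \<Delta> = mass \<Theta>"
    using assms(1) by (rule sat_bisimilarE)
  show ?thesis
  proof (cases "mass \<Delta> = 0")
    case True
    then show ?thesis using T(3) dist_typed_None mass_0_iff by metis
  next
    case False
    then show ?thesis using dist_typed_unique[OF assms(2) T(1)] T(2) by simp
  qed
qed

lemma dist_trans_None:
  assumes "dist_trans (return_pmf None) \<mu> \<delta> \<Theta>"
  shows "\<Theta> = return_pmf None"
proof -
  have "set_pmf \<Theta> \<subseteq> {None}"
  proof
    fix y assume "y \<in> set_pmf \<Theta>"
    then show "y \<in> {None}"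
      by (cases y) (auto elim: dist_trans_set_pmf[OF assms])
  qed
  then show ?thesis by (simp add: set_pmf_subset_singleton)
qed

text \<open>Bisimilarity provides one type of the pair; this is any other one (they differ only for
  mass zero). The type of the successor comes with its bisimilarity, up to identification of the
  process type, so that no preservation of density operators has to be shown.\<close>

lemma sat_bisimilar_fill_trans:
  assumes bisim: "\<Delta> \<sim>\<^sub>s \<Theta>" and \<Delta>: "dist_typed S S' \<Delta>"
    and B: "ctx_typed U B" "hole B = S'" "U \<subseteq> S"
    and det: "det_tagged (fill B \<Delta>)" "det_tagged (fill B \<Theta>)"
    and tr: "dist_trans (fill B \<Delta>) ATau \<delta> \<Delta>'"
  obtains \<Theta>' where "dist_trans (fill B \<Theta>) ATau \<delta> \<Theta>'" "\<Delta>' \<sim>\<^sub>s \<Theta>'" "dist_typed S U \<Delta>'"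
proof -
  obtain T T' where T: "dist_typed T T' \<Delta>" "mass \<Delta> = mass \<Theta>"
    and step: "sat_step (\<sim>\<^sub>s) T T' \<Delta> \<Theta>"
    using bisim by (rule sat_bisimilarE)
  show thesis
  proof (cases "mass \<Delta> = 0")
    case True
    then have None: "\<Delta> = return_pmf None" "\<Theta> = return_pmf None" using T(2) mass_0_iff by metis+
    then have "\<Delta>' = return_pmf None" using tr by (simp add: fill_def dist_trans_None)
    \<comment> \<open>Both filled distributions are bottom, so the given step matches
      itself.\<close>
    with None tr bisim show thesis by (intro that[of \<Delta>']) (auto simp: dist_typed_None)
  next
    case False
    have "S = T" "S' = T'" using \<Delta> T(1) False by (rule dist_typed_unique)+
    then obtain \<Theta>' where \<Theta>': "dist_trans (fill B \<Theta>) ATau \<delta> \<Theta>'" "\<Delta>' \<sim>\<^sub>s \<Theta>'"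
      using step B det tr dist_trans_finite_sched[OF tr] unfolding sat_step_def by blast
    obtain V V' where V: "dist_typed V V' \<Delta>'" using \<Theta>'(2) by (rule sat_bisimilarE)
    have "dist_typed S U \<Delta>'"
    proof (cases "mass \<Delta>' = 0")
      case True
      then show ?thesis by (simp add: mass_0_iff dist_typed_None)
    next
      case False
      then obtain C' where C': "Some C' \<in> set_pmf \<Delta>'" by (rule mass_nonzeroE)
      have "conf_typed V V' C'" using V C' by (simp add: dist_typed_def)
      then have "V = S" "V' = U" using fill_trans_typed[OF \<Delta> B(1,2) tr C']
        by (auto simp: conf_typed_def qnames_inj dest: proc_typed_unique)
      with V show ?thesis by simp
    qed
    with \<Theta>' show thesis by (rule that)
  qed
qed

section \<open>Mixtures inside contexts\<close>

lemma fill_pchoice: "fill B (pchoice p \<Delta> \<Theta>) = pchoice p (fill B \<Delta>) (fill B \<Theta>)"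
  unfolding fill_def by (rule map_pmf_pchoice)

lemma dist_typed_pchoice:
  assumes "0 < p" "p < 1"
  shows "dist_typed S S' (pchoice p A B) \<longleftrightarrow> dist_typed S S' A \<and> dist_typed S S' B"
  using assms by (auto simp: dist_typed_def set_pmf_pchoice)

lemma dist_typed_finite_fill: "dist_typed S S' \<Delta> \<Longrightarrow> finite (set_pmf (fill B \<Delta>))"
  by (simp add: dist_typed_def fill_def)

text \<open>The components are matched separately. Both successors receive the same type
  \<open>S\<close>, \<open>U\<close>, which makes their mixture typed.\<close>

lemma sat_bisimilar_pchoice_fill_trans:
  assumes p: "0 < p" "p < 1"
    and bisim: "\<Delta>1 \<sim>\<^sub>s \<Theta>1" "\<Delta>2 \<sim>\<^sub>s \<Theta>2"
    and typed: "dist_typed S S' (pchoice p \<Delta>1 \<Delta>2)"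
    and B: "ctx_typed U B" "hole B = S'" "U \<subseteq> S"
    and det: "det_tagged (fill B (pchoice p \<Delta>1 \<Delta>2))" "det_tagged (fill B (pchoice p \<Theta>1 \<Theta>2))"
    and tr: "dist_trans (fill B (pchoice p \<Delta>1 \<Delta>2)) ATau \<delta> \<Delta>'"
  shows "\<exists>\<Delta>1' \<Delta>2' \<Theta>1' \<Theta>2'. \<Delta>' = pchoice p \<Delta>1' \<Delta>2' \<and>
    dist_trans (fill B (pchoice p \<Theta>1 \<Theta>2)) ATau \<delta> (pchoice p \<Theta>1' \<Theta>2') \<and>
    \<Delta>1' \<sim>\<^sub>s \<Theta>1' \<and> \<Delta>2' \<sim>\<^sub>s \<Theta>2' \<and> dist_typed S U \<Delta>'"
proof -
  have \<Delta>: "dist_typed S S' \<Delta>1" "dist_typed S S' \<Delta>2" using typed p by (auto simp: dist_typed_pchoice)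
  then have \<Theta>: "dist_typed S S' \<Theta>1" "dist_typed S S' \<Theta>2" using bisim sat_bisimilar_typed by blast+
  note fin = \<Delta>[THEN dist_typed_finite_fill, of B] \<Theta>[THEN dist_typed_finite_fill, of B]
  \<comment> \<open>Matching in the components requires the context to be deterministic with each of
    them, while this is given only for the mixtures.\<close>
  have det': "det_tagged (fill B \<Delta>1)" "det_tagged (fill B \<Delta>2)"
    "det_tagged (fill B \<Theta>1)" "det_tagged (fill B \<Theta>2)"
    using det p fin by (auto simp: fill_pchoice det_tagged_pchoice_iff)
  obtain \<Delta>1' \<Delta>2' where \<Delta>': "\<Delta>' = pchoice p \<Delta>1' \<Delta>2'"
    "dist_trans (fill B \<Delta>1) ATau \<delta> \<Delta>1'" "dist_trans (fill B \<Delta>2) ATau \<delta> \<Delta>2'"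
    using tr p unfolding fill_pchoice dist_trans_def by (rule lift_rel_pchoiceE)
  obtain \<Theta>1' where 1: "dist_trans (fill B \<Theta>1) ATau \<delta> \<Theta>1'" "\<Delta>1' \<sim>\<^sub>s \<Theta>1'" "dist_typed S U \<Delta>1'"
    using bisim(1) \<Delta>(1) B det'(1,3) \<Delta>'(2) by (rule sat_bisimilar_fill_trans)
  obtain \<Theta>2' where 2: "dist_trans (fill B \<Theta>2) ATau \<delta> \<Theta>2'" "\<Delta>2' \<sim>\<^sub>s \<Theta>2'" "dist_typed S U \<Delta>2'"
    using bisim(2) \<Delta>(2) B det'(2,4) \<Delta>'(3) by (rule sat_bisimilar_fill_trans)
  have "dist_trans (fill B (pchoice p \<Theta>1 \<Theta>2)) ATau \<delta> (pchoice p \<Theta>1' \<Theta>2')"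
    using 1(1) 2(1) unfolding fill_pchoice dist_trans_def by (rule lift_rel_pchoice)
  with \<Delta>'(1) 1 2 p show ?thesis by (auto simp: dist_typed_pchoice)
qed

theorem theorem3:
  fixes \<Delta>1 \<Delta>2 \<Theta>1 \<Theta>2 :: "'t dist" and p :: real
  assumes "\<Delta>1 \<sim>\<^sub>s \<Theta>1" and "\<Delta>2 \<sim>\<^sub>s \<Theta>2"
    and "p \<in> {0..1}"
    and "well_typed (pchoice p \<Delta>1 \<Delta>2)"
  shows "pchoice p \<Delta>1 \<Delta>2 \<sim>\<^sub>s pchoice p \<Theta>1 \<Theta>2"
proof -
  \<comment> \<open>Splitting a step of a mixture needs both weights positive, so the endpoints,
    where the mixture is one of its components, are treated apart.\<close>
  consider "p = 0" | "p = 1" | "0 < p" "p < 1" using assms(3) by force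
  then show ?thesis
  proof cases
    case p: 3
    define R where "R = (\<lambda>\<Delta> \<Theta> :: 't dist. \<exists>\<Delta>1 \<Delta>2 \<Theta>1 \<Theta>2. \<Delta> = pchoice p \<Delta>1 \<Delta>2 \<and>
      \<Theta> = pchoice p \<Theta>1 \<Theta>2 \<and> \<Delta>1 \<sim>\<^sub>s \<Theta>1 \<and> \<Delta>2 \<sim>\<^sub>s \<Theta>2 \<and> well_typed \<Delta>)"
    \<comment> \<open>Types pass to the right side, so \<open>R\<close> is symmetric although it
      requires a type only on the left.\<close>
    have typed: "dist_typed S S' (pchoice p \<Theta>1 \<Theta>2)"
      if "\<Delta>1 \<sim>\<^sub>s \<Theta>1" "\<Delta>2 \<sim>\<^sub>s \<Theta>2" "dist_typed S S' (pchoice p \<Delta>1 \<Delta>2)"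
      for S S' and \<Delta>1 \<Delta>2 \<Theta>1 \<Theta>2 :: "'t dist"
      using that p sat_bisimilar_typed by (auto simp: dist_typed_pchoice)
    have sym: "R \<Theta> \<Delta>" if "R \<Delta> \<Theta>" for \<Delta> \<Theta>
      using that typed sat_bisimilar_sym unfolding R_def well_typed_def by metis
    have step: "sat_step R S S' \<Delta> \<Theta>" if "R \<Delta> \<Theta>" "dist_typed S S' \<Delta>" for \<Delta> \<Theta> S S'
      unfolding sat_step_def
    proof (intro allI impI, elim conjE)
      fix B U \<delta> \<Delta>'
      assume *: "ctx_typed U B" "hole B = S'" "U \<subseteq> S" "det_tagged (fill B \<Delta>)"
        "det_tagged (fill B \<Theta>)" "dist_trans (fill B \<Delta>) ATau \<delta> \<Delta>'"
      obtain \<Delta>1 \<Delta>2 \<Theta>1 \<Theta>2 where "\<Delta> = pchoice p \<Delta>1 \<Delta>2" "\<Theta> = pchoice p \<Theta>1 \<Theta>2"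
        "\<Delta>1 \<sim>\<^sub>s \<Theta>1" "\<Delta>2 \<sim>\<^sub>s \<Theta>2" using \<open>R \<Delta> \<Theta>\<close> unfolding R_def by blast
      then show "\<exists>\<Theta>'. dist_trans (fill B \<Theta>) ATau \<delta> \<Theta>' \<and> R \<Delta>' \<Theta>'"
        using sat_bisimilar_pchoice_fill_trans[OF p, of \<Delta>1 \<Theta>1 \<Delta>2 \<Theta>2 S S' U B \<delta> \<Delta>'] * that(2)
        unfolding R_def well_typed_def by blast
    qed
    \<comment> \<open>Symmetry reduces both transfer clauses to \<open>step\<close>.\<close>
    have converse: "R\<inverse>\<inverse> = R" using sym by (auto intro!: ext)
    have "sat_bisim R"
      unfolding sat_bisim_iff converse
    proof (intro allI impI)
      fix \<Delta> \<Theta> assume R: "R \<Delta> \<Theta>"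
      then obtain \<Delta>1 \<Delta>2 \<Theta>1 \<Theta>2 S S' where eq: "\<Delta> = pchoice p \<Delta>1 \<Delta>2" "\<Theta> = pchoice p \<Theta>1 \<Theta>2"
        and bisim: "\<Delta>1 \<sim>\<^sub>s \<Theta>1" "\<Delta>2 \<sim>\<^sub>s \<Theta>2" and \<Delta>: "dist_typed S S' \<Delta>"
        unfolding R_def well_typed_def by blast
      have \<Theta>: "dist_typed S S' \<Theta>" using typed bisim \<Delta> eq by blast
      have "det_tagged \<Delta>" "det_tagged \<Theta>" "mass \<Delta> = mass \<Theta>"
        using p bisim unfolding eq
        by (auto elim!: sat_bisimilarE intro!: det_tagged_pchoice simp: mass_def pmf_pchoice)
      with \<Delta> \<Theta> step[OF R \<Delta>] step[OF sym[OF R] \<Theta>]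
      show "det_tagged \<Delta> \<and> det_tagged \<Theta> \<and> (\<exists>S S'. dist_typed S S' \<Delta> \<and> dist_typed S S' \<Theta> \<and>
          mass \<Delta> = mass \<Theta> \<and> sat_step R S S' \<Delta> \<Theta> \<and> sat_step R S S' \<Theta> \<Delta>)"
        by blast
    qed
    moreover have "R (pchoice p \<Delta>1 \<Delta>2) (pchoice p \<Theta>1 \<Theta>2)"
      using assms unfolding R_def by blast
    ultimately show ?thesis unfolding sat_bisimilar_def by blast
  qed (use assms in \<open>simp_all add: pchoice_0 pchoice_1\<close>)
qed

end
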